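(* Suppose $X$ is a separable Banach space admitting an uncollapsed uniformly continuous map into a super-reflexive Banach space. Then $X$ admits a coarsely proper continuous cocycle with values in a super-reflexive Banach space.
   Context: For a map $\sigma\colon (X,d)\to (Y,\partial)$ between metric spaces put $\kappa_\sigma(t)=\inf\{\partial(\sigma(a),\sigma(b)) : d(a,b)\geqslant t\}$ and $\theta_\sigma(t)=\sup\{\partial(\sigma(a),\sigma(b)) : d(a,b)\leqslant t\}$. The map $\sigma$ is uniformly continuous if $\lim_{t\to 0_+}\theta_\sigma(t)=0$; a coarse embedding if $\theta_\sigma(t)<\infty$ for all $t<\infty$ and $\lim_{t\to\infty}\kappa_\sigma(t)=\infty$; uncollapsed if $\kappa_\sigma(t)>0$ for some $t>0$. Banach spaces carry their norm metric. A Banach space is super-reflexive if it admits an equivalent uniformly convex norm (equivalently, if every Banach space crudely finitely representable in it is reflexive). A continuous cocycle on $X$ with values in a Banach space $V$ is a continuous map $b\colon X\to V$ for which there is a strongly continuous isometric linear representation $\pi$ of the additive topological group $(X,+)$ on $V$ with $b(x+y)=\pi(x)b(y)+b(x)$ for all $x,y\in X$. It is coarsely proper if $b$ is a coarse embedding of $X$ into $V$. *)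

theory Defs
  imports "HOL-Analysis.Analysis"
begin

section \<open>Moduli of maps between metric spaces\<close>

text \<open>
  The moduli take values in \<open>[0,\<infinity>]\<close>, with \<open>Inf {} = \<infinity>\<close>.
\<close>

definition kappa :: "'a metric \<Rightarrow> 'b metric \<Rightarrow> ('a \<Rightarrow> 'b) \<Rightarrow> real \<Rightarrow> ennreal" where
  "kappa m1 m2 \<sigma> t =
     Inf {ennreal (mdist m2 (\<sigma> a) (\<sigma> b)) | a b.
            a \<in> mspace m1 \<and> b \<in> mspace m1 \<and> mdist m1 a b \<ge> t}"

definition theta :: "'a metric \<Rightarrow> 'b metric \<Rightarrow> ('a \<Rightarrow> 'b) \<Rightarrow> real \<Rightarrow> ennreal" where
  "theta m1 m2 \<sigma> t =
     Sup {ennreal (mdist m2 (\<sigma> a) (\<sigma> b)) | a b.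
            a \<in> mspace m1 \<and> b \<in> mspace m1 \<and> mdist m1 a b \<le> t}"

definition uncollapsed :: "'a metric \<Rightarrow> 'b metric \<Rightarrow> ('a \<Rightarrow> 'b) \<Rightarrow> bool" where
  "uncollapsed m1 m2 \<sigma> \<longleftrightarrow> (\<exists>t>0. kappa m1 m2 \<sigma> t > 0)"

definition coarse_embedding :: "'a metric \<Rightarrow> 'b metric \<Rightarrow> ('a \<Rightarrow> 'b) \<Rightarrow> bool" where
  "coarse_embedding m1 m2 \<sigma> \<longleftrightarrow>
     \<sigma> ` mspace m1 \<subseteq> mspace m2 \<and>
     (\<forall>t. theta m1 m2 \<sigma> t < \<infinity>) \<and>
     (kappa m1 m2 \<sigma> \<longlongrightarrow> \<infinity>) at_top"

text \<open>
  Uniform continuity in terms of \<^const>\<open>theta\<close> is the library notion.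
\<close>

lemma uniformly_continuous_map_iff_theta:
  "uniformly_continuous_map m1 m2 \<sigma> \<longleftrightarrow>
     \<sigma> ` mspace m1 \<subseteq> mspace m2 \<and> (theta m1 m2 \<sigma> \<longlongrightarrow> 0) (at_right 0)"
proof (intro iffI conjI)
  assume u: "uniformly_continuous_map m1 m2 \<sigma>"
  then show "\<sigma> ` mspace m1 \<subseteq> mspace m2"
    by (auto simp: uniformly_continuous_map_def)
  show "(theta m1 m2 \<sigma> \<longlongrightarrow> 0) (at_right 0)"
  proof (rule order_tendstoI)
    fix a :: ennreal assume "0 < a"
    then obtain c where c: "0 < c" "c < a" using dense by blast
    define e where "e = enn2real c"
    have ce: "c = ennreal e"
      unfolding e_def using c by (metis ennreal_enn2real order_less_le_trans top_greatest)
    have e: "e > 0" using c ce by simp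
    from u e obtain d where d: "d > 0"
      "\<And>x y. x \<in> mspace m1 \<Longrightarrow> y \<in> mspace m1 \<Longrightarrow> mdist m1 y x < d \<Longrightarrow> mdist m2 (\<sigma> y) (\<sigma> x) < e"
      unfolding uniformly_continuous_map_def by meson
    have "theta m1 m2 \<sigma> t < a" if "0 < t" "t < d" for t
    proof -
      have "theta m1 m2 \<sigma> t \<le> c"
        unfolding theta_def ce using d(2) that
        by (intro Sup_least) (force intro: ennreal_leI)
      then show ?thesis using c by simp
    qed
    then show "\<forall>\<^sub>F t in at_right 0. theta m1 m2 \<sigma> t < a"
      using d(1) unfolding eventually_at_right_field by blast
  qed simp
next
  assume "\<sigma> ` mspace m1 \<subseteq> mspace m2 \<and> (theta m1 m2 \<sigma> \<longlongrightarrow> 0) (at_right 0)"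
  then have im: "\<sigma> ` mspace m1 \<subseteq> mspace m2"
    and lim: "(theta m1 m2 \<sigma> \<longlongrightarrow> 0) (at_right 0)" by auto
  show "uniformly_continuous_map m1 m2 \<sigma>"
    unfolding uniformly_continuous_map_def
  proof (intro conjI allI impI)
    show "\<sigma> \<in> mspace m1 \<rightarrow> mspace m2" using im by auto
    fix e :: real assume "e > 0"
    then have "\<forall>\<^sub>F t in at_right 0. theta m1 m2 \<sigma> t < ennreal e"
      using order_tendstoD(2)[OF lim] by simp
    then obtain d where d: "d > 0" "\<And>t. 0 < t \<Longrightarrow> t < d \<Longrightarrow> theta m1 m2 \<sigma> t < ennreal e"
      unfolding eventually_at_right_field by blast
    have "mdist m2 (\<sigma> y) (\<sigma> x) < e"
      if "x \<in> mspace m1" "y \<in> mspace m1" "mdist m1 y x < d/2" for x y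
    proof -
      have "ennreal (mdist m2 (\<sigma> y) (\<sigma> x)) \<le> theta m1 m2 \<sigma> (d/2)"
        unfolding theta_def using that by (intro Sup_upper) force
      also have "\<dots> < ennreal e" using d by simp
      finally show ?thesis using \<open>e > 0\<close> by (simp add: ennreal_less_iff)
    qed
    then show "\<exists>\<delta>>0. \<forall>x\<in>mspace m1. \<forall>y\<in>mspace m1.
        mdist m1 y x < \<delta> \<longrightarrow> mdist m2 (\<sigma> y) (\<sigma> x) < e"
      using d(1) by (intro exI[of _ "d/2"]) auto
  qed
qed

corollary uniformly_continuous_on_iff_theta:
  fixes \<sigma> :: "'a::metric_space \<Rightarrow> 'b::metric_space"
  shows "uniformly_continuous_on UNIV \<sigma> \<longleftrightarrow>
           (theta euclidean_metric euclidean_metric \<sigma> \<longlongrightarrow> 0) (at_right 0)"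
  using uniformly_continuous_map_iff_theta[of euclidean_metric euclidean_metric \<sigma>]
  by (simp add: uniformly_continuous_map_def uniformly_continuous_on_def)


section \<open>Banach spaces as explicit structures\<close>

text \<open>
  A type class cannot be used for a space whose existence is asserted, so a normed space is
  also represented as a record with an explicit carrier set.  Nothing is assumed about the
  operations outside the carrier.

  When the existence of a cocycle \<open>b\<close> on a separable space is asserted, carriers inside a type of
  the cardinality of the continuum, such as \<open>nat \<Rightarrow> real\<close>, are no restriction: the closed linear
  span of the range of \<open>b\<close> is separable, complete, invariant under the representation, and
  super-reflexive if the ambient space is; and a separable metric space with dense sequence
  \<open>d\<close> injects into \<open>nat \<Rightarrow> real\<close> by \<open>v \<mapsto> (\<lambda>n. dist v (d n))\<close>.
\<close>

record 'v nspace =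
  car :: "'v set"
  zer :: "'v"
  plu :: "'v \<Rightarrow> 'v \<Rightarrow> 'v"
  scl :: "real \<Rightarrow> 'v \<Rightarrow> 'v"
  nrm :: "'v \<Rightarrow> real"

definition is_vector_space :: "'v nspace \<Rightarrow> bool" where
  "is_vector_space V \<longleftrightarrow>
     zer V \<in> car V \<and>
     (\<forall>x\<in>car V. \<forall>y\<in>car V. plu V x y \<in> car V) \<and>
     (\<forall>a. \<forall>x\<in>car V. scl V a x \<in> car V) \<and>
     (\<forall>x\<in>car V. \<forall>y\<in>car V. \<forall>z\<in>car V. plu V (plu V x y) z = plu V x (plu V y z)) \<and>
     (\<forall>x\<in>car V. \<forall>y\<in>car V. plu V x y = plu V y x) \<and>
     (\<forall>x\<in>car V. plu V (zer V) x = x) \<and>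
     (\<forall>x\<in>car V. \<exists>y\<in>car V. plu V x y = zer V) \<and>
     (\<forall>a. \<forall>x\<in>car V. \<forall>y\<in>car V. scl V a (plu V x y) = plu V (scl V a x) (scl V a y)) \<and>
     (\<forall>a b. \<forall>x\<in>car V. scl V (a + b) x = plu V (scl V a x) (scl V b x)) \<and>
     (\<forall>a b. \<forall>x\<in>car V. scl V a (scl V b x) = scl V (a * b) x) \<and>
     (\<forall>x\<in>car V. scl V 1 x = x)"

definition vdiff :: "'v nspace \<Rightarrow> 'v \<Rightarrow> 'v \<Rightarrow> 'v" where
  "vdiff V x y = plu V x (scl V (- 1) y)"

definition is_norm :: "'v nspace \<Rightarrow> ('v \<Rightarrow> real) \<Rightarrow> bool" where
  "is_norm V N \<longleftrightarrow>
     (\<forall>x\<in>car V. N x \<ge> 0) \<and>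
     (\<forall>x\<in>car V. N x = 0 \<longleftrightarrow> x = zer V) \<and>
     (\<forall>x\<in>car V. \<forall>y\<in>car V. N (plu V x y) \<le> N x + N y) \<and>
     (\<forall>a. \<forall>x\<in>car V. N (scl V a x) = \<bar>a\<bar> * N x)"

definition is_normed_space :: "'v nspace \<Rightarrow> bool" where
  "is_normed_space V \<longleftrightarrow> is_vector_space V \<and> is_norm V (nrm V)"

text \<open>
  \<^const>\<open>Metric_space\<close> requires the distance to be nonnegative and symmetric off the carrier
  as well, hence the value 0 there.
\<close>

definition norm_dist :: "'v nspace \<Rightarrow> 'v \<Rightarrow> 'v \<Rightarrow> real" where
  "norm_dist V x y = (if x \<in> car V \<and> y \<in> car V then nrm V (vdiff V x y) else 0)"

definition norm_metric :: "'v nspace \<Rightarrow> 'v metric" where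
  "norm_metric V = metric (car V, norm_dist V)"

lemma Metric_space_norm_dist:
  assumes "is_normed_space V"
  shows "Metric_space (car V) (norm_dist V)"
proof -
  have zc: "zer V \<in> car V"
    and pc: "\<And>x y. x \<in> car V \<Longrightarrow> y \<in> car V \<Longrightarrow> plu V x y \<in> car V"
    and sc: "\<And>a x. x \<in> car V \<Longrightarrow> scl V a x \<in> car V"
    and as: "\<And>x y z. x \<in> car V \<Longrightarrow> y \<in> car V \<Longrightarrow> z \<in> car V \<Longrightarrow>
               plu V (plu V x y) z = plu V x (plu V y z)"
    and co: "\<And>x y. x \<in> car V \<Longrightarrow> y \<in> car V \<Longrightarrow> plu V x y = plu V y x"
    and z: "\<And>x. x \<in> car V \<Longrightarrow> plu V (zer V) x = x"
    and sd: "\<And>a x y. x \<in> car V \<Longrightarrow> y \<in> car V \<Longrightarrow>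
               scl V a (plu V x y) = plu V (scl V a x) (scl V a y)"
    and ds: "\<And>a b x. x \<in> car V \<Longrightarrow> scl V (a + b) x = plu V (scl V a x) (scl V b x)"
    and ss: "\<And>a b x. x \<in> car V \<Longrightarrow> scl V a (scl V b x) = scl V (a * b) x"
    and s1: "\<And>x. x \<in> car V \<Longrightarrow> scl V 1 x = x"
    and n0: "\<And>x. x \<in> car V \<Longrightarrow> nrm V x \<ge> 0"
    and nz: "\<And>x. x \<in> car V \<Longrightarrow> nrm V x = 0 \<longleftrightarrow> x = zer V"
    and nt: "\<And>x y. x \<in> car V \<Longrightarrow> y \<in> car V \<Longrightarrow> nrm V (plu V x y) \<le> nrm V x + nrm V y"
    and ns: "\<And>a x. x \<in> car V \<Longrightarrow> nrm V (scl V a x) = \<bar>a\<bar> * nrm V x"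
    using assms unfolding is_normed_space_def is_vector_space_def is_norm_def by auto
  let ?m = "scl V (- 1)"
  have s0: "scl V 0 x = zer V" if "x \<in> car V" for x
    using ns[OF that, of 0] nz[OF sc[OF that]] by simp
  have inv: "plu V x (?m x) = zer V" if "x \<in> car V" for x
    using ds[OF that, of 1 "- 1"] s0[OF that] s1[OF that] by simp
  have zr: "plu V x (zer V) = x" if "x \<in> car V" for x
    using co[OF that zc] z[OF that] by simp
  have vc: "vdiff V x y \<in> car V" if "x \<in> car V" "y \<in> car V" for x y
    unfolding vdiff_def using that pc sc by simp
  have mm: "?m (?m x) = x" if "x \<in> car V" for x
    using ss[OF that, of "- 1" "- 1"] s1[OF that] by simp
  have neg: "?m (vdiff V x y) = vdiff V y x" if "x \<in> car V" "y \<in> car V" for x y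
    unfolding vdiff_def using that by (simp add: sd sc mm co)
  have tri: "plu V (vdiff V x y) (vdiff V y w) = vdiff V x w"
    if "x \<in> car V" "y \<in> car V" "w \<in> car V" for x y w
  proof -
    have "plu V (?m y) (plu V y (?m w)) = plu V (plu V (?m y) y) (?m w)"
      using that as sc by simp
    also have "\<dots> = ?m w" using that inv co sc z by metis
    finally show ?thesis unfolding vdiff_def using that as sc pc by simp
  qed
  have eq: "vdiff V x y = zer V \<longleftrightarrow> x = y" if "x \<in> car V" "y \<in> car V" for x y
  proof
    assume *: "vdiff V x y = zer V"
    have "plu V (vdiff V x y) y = plu V x (plu V (?m y) y)"
      unfolding vdiff_def using that as sc by simp
    also have "\<dots> = x" using that inv co sc zr by metis
    finally show "x = y" using * z that by simp
  qed (use inv that in \<open>simp add: vdiff_def\<close>)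
  show ?thesis
  proof
    show "0 \<le> norm_dist V x y" for x y
      using n0 vc by (simp add: norm_dist_def)
    show "norm_dist V x y = norm_dist V y x" for x y
      using neg[of x y] ns[OF vc, of x y "- 1"] by (auto simp: norm_dist_def)
    show "norm_dist V x y = 0 \<longleftrightarrow> x = y" if "x \<in> car V" "y \<in> car V" for x y
      using that nz vc eq by (simp add: norm_dist_def)
    show "norm_dist V x w \<le> norm_dist V x y + norm_dist V y w"
      if "x \<in> car V" "y \<in> car V" "w \<in> car V" for x y w
      using that nt[OF vc vc, of x y y w] tri by (simp add: norm_dist_def)
  qed
qed

lemma norm_metric_simps:
  assumes "is_normed_space V"
  shows "mspace (norm_metric V) = car V" "mdist (norm_metric V) = norm_dist V"
  using Metric_space_norm_dist[OF assms]
  by (simp_all add: norm_metric_def Metric_space.mspace_metric Metric_space.mdist_metric)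

definition is_banach_space :: "'v nspace \<Rightarrow> bool" where
  "is_banach_space V \<longleftrightarrow> is_normed_space V \<and> mcomplete_of (norm_metric V)"

definition equivalent_norm :: "'v nspace \<Rightarrow> ('v \<Rightarrow> real) \<Rightarrow> bool" where
  "equivalent_norm V N \<longleftrightarrow>
     is_norm V N \<and>
     (\<exists>c>0. \<exists>C>0. \<forall>x\<in>car V. c * nrm V x \<le> N x \<and> N x \<le> C * nrm V x)"

definition uniformly_convex_norm :: "'v nspace \<Rightarrow> ('v \<Rightarrow> real) \<Rightarrow> bool" where
  "uniformly_convex_norm V N \<longleftrightarrow>
     (\<forall>\<epsilon>>0. \<exists>\<delta>>0. \<forall>x\<in>car V. \<forall>y\<in>car V.
        N x = 1 \<longrightarrow> N y = 1 \<longrightarrow> N (vdiff V x y) \<ge> \<epsilon> \<longrightarrow>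
        N (scl V (1/2) (plu V x y)) \<le> 1 - \<delta>)"

definition super_reflexive :: "'v nspace \<Rightarrow> bool" where
  "super_reflexive V \<longleftrightarrow>
     is_banach_space V \<and> (\<exists>N. equivalent_norm V N \<and> uniformly_convex_norm V N)"

text \<open>The structure carried by a type of class \<^class>\<open>real_normed_vector\<close>.\<close>

definition type_space :: "'a::real_normed_vector nspace" where
  "type_space = \<lparr>car = UNIV, zer = 0, plu = (+), scl = (*\<^sub>R), nrm = norm\<rparr>"

lemma type_space_simps [simp]:
  "car type_space = UNIV" "zer type_space = 0" "plu type_space = (+)"
  "scl type_space = (*\<^sub>R)" "nrm type_space = norm"
  by (simp_all add: type_space_def)

lemma norm_metric_type_space:
  "norm_metric (type_space :: 'a::real_normed_vector nspace) = euclidean_metric"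
  by (simp add: norm_metric_def euclidean_metric_def norm_dist_def[abs_def]
      vdiff_def dist_norm[abs_def])

lemma is_banach_space_type_space: "is_banach_space (type_space :: 'a::banach nspace)"
proof -
  have "is_normed_space (type_space :: 'a nspace)"
    by (auto simp: is_normed_space_def is_vector_space_def is_norm_def
        algebra_simps norm_triangle_ineq intro: exI[of _ "- _"])
  moreover have "mcomplete_of (euclidean_metric :: 'a metric)"
    by (simp add: mcomplete_of_def complete_UNIV)
  ultimately show ?thesis
    by (simp add: is_banach_space_def norm_metric_type_space)
qed

section \<open>Cocycles\<close>

definition linear_isometry :: "'v nspace \<Rightarrow> ('v \<Rightarrow> 'v) \<Rightarrow> bool" where
  "linear_isometry V T \<longleftrightarrow>
     (\<forall>v\<in>car V. T v \<in> car V) \<and>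
     (\<forall>v\<in>car V. \<forall>w\<in>car V. T (plu V v w) = plu V (T v) (T w)) \<and>
     (\<forall>a. \<forall>v\<in>car V. T (scl V a v) = scl V a (T v)) \<and>
     (\<forall>v\<in>car V. nrm V (T v) = nrm V v)"

text \<open>
  Each \<open>\<pi> x\<close> is automatically onto, with inverse \<open>\<pi> (- x)\<close>.
\<close>

definition isometric_representation ::
    "'v nspace \<Rightarrow> ('a::topological_group_add \<Rightarrow> 'v \<Rightarrow> 'v) \<Rightarrow> bool" where
  "isometric_representation V \<pi> \<longleftrightarrow>
     (\<forall>x. linear_isometry V (\<pi> x)) \<and>
     (\<forall>v\<in>car V. \<pi> 0 v = v) \<and>
     (\<forall>x y. \<forall>v\<in>car V. \<pi> (x + y) v = \<pi> x (\<pi> y v))"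

definition strongly_continuous ::
    "'v nspace \<Rightarrow> ('a::topological_group_add \<Rightarrow> 'v \<Rightarrow> 'v) \<Rightarrow> bool" where
  "strongly_continuous V \<pi> \<longleftrightarrow>
     (\<forall>v\<in>car V. continuous_map euclidean (mtopology_of (norm_metric V)) (\<lambda>x. \<pi> x v))"

definition continuous_cocycle ::
    "'v nspace \<Rightarrow> ('a::topological_group_add \<Rightarrow> 'v) \<Rightarrow> bool" where
  "continuous_cocycle V b \<longleftrightarrow>
     continuous_map euclidean (mtopology_of (norm_metric V)) b \<and>
     (\<exists>\<pi>. isometric_representation V \<pi> \<and> strongly_continuous V \<pi> \<and>
          (\<forall>x y. b (x + y) = plu V (\<pi> x (b y)) (b x)))"

definition coarsely_proper ::
    "'v nspace \<Rightarrow> ('a::real_normed_vector \<Rightarrow> 'v) \<Rightarrow> bool" where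
  "coarsely_proper V b \<longleftrightarrow> coarse_embedding euclidean_metric (norm_metric V) b"

end

theory Submission
  imports Defs
begin

text \<open>
  Translating and rescaling, \<open>\<sigma>\<close> yields the maps
  \<open>x \<mapsto> \<sigma> (l n *\<^sub>R (x + g)) - \<sigma> (l n *\<^sub>R g)\<close>, where the scales \<open>l n\<close> decrease so fast that
  points at distance at most \<open>n + 1\<close> have images at distance at most \<open>2\<^sup>-\<^sup>n\<close>.  Taking
  an \<open>\<ell>\<^sup>2\<close> sum over \<open>n\<close> turns the uncollapsed map into a coarse embedding, and averaging the squared
  norm over \<open>g\<close> by an invariant mean of the abelian group makes the seminorm invariant under
  translation.  The maps then form a cocycle for the translation action on their linear span, whose
  Hausdorff completion is the required space.

  Uniform convexity survives averaging and completion in the form: for every \<open>\<epsilon> > 0\<close> there is \<open>C\<close> with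
  \<open>|x - y|\<^sup>2 \<le> \<epsilon> (|x|\<^sup>2 + |y|\<^sup>2) + C ((|x|\<^sup>2 + |y|\<^sup>2) / 2 - |(x + y) / 2|\<^sup>2)\<close>, since
  this is linear in the squared norms.
\<close>

subsection \<open>Invariant means on abelian groups\<close>

text \<open>An invariant mean is only finitely additive, so it provides no L^2 space to work in: it
  yields just a seminorm, whose kernel and incompleteness have to be removed by hand. Squares are
  averaged because a mean, being linear and positive, preserves exactly the inequalities that are
  linear in squared norms; even the triangle inequality is recovered from a family of such
  inequalities.

  The obstacle is that an uncollapsed map guarantees one fixed gap \<delta> between images of points
  at least t0 apart, and no growth. The levels supply the growth: at distance r every level with l n
  * r \<ge> t0 contributes at least a fixed amount, and the number of such levels tends to infinity
  with r. The levels with n + 1 \<ge> r together contribute at most a geometric series, and the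
  finitely many others are bounded because \<sigma> moves points at bounded distance by a bounded
  amount.

  Separability keeps the target inside the type \<open>nat \<Rightarrow> real\<close>: only the span
  of the values of the cocycle is completed, and this span is separable for the seminorm.\<close>

text \<open>Junk value 0 on unbounded functions, so that the set of means is compact for the product
  topology.\<close>

definition is_mean :: "(('a \<Rightarrow> real) \<Rightarrow> real) \<Rightarrow> bool" where
  "is_mean m \<longleftrightarrow>
     (\<forall>f g. bounded (range f) \<longrightarrow> bounded (range g) \<longrightarrow> m (\<lambda>x. f x + g x) = m f + m g) \<and>
     (\<forall>c f. bounded (range f) \<longrightarrow> m (\<lambda>x. c * f x) = c * m f) \<and>
     (\<forall>f. bounded (range f) \<longrightarrow> (\<forall>x. 0 \<le> f x) \<longrightarrow> 0 \<le> m f) \<and>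
     m (\<lambda>_. 1) = 1 \<and>
     (\<forall>f. \<not> bounded (range f) \<longrightarrow> m f = 0)"

lemma bounded_range_const: "bounded (range (\<lambda>_. c))" for c :: "'b::real_normed_vector"
  by (rule boundedI[of _ "norm c"]) auto

lemma bounded_range_realI: "(\<And>x. \<bar>f x\<bar> \<le> c) \<Longrightarrow> bounded (range f)" for f :: "'a \<Rightarrow> real"
  by (rule boundedI[of _ c]) auto

lemma bounded_range_realE:
  fixes f :: "'a \<Rightarrow> real"
  assumes "bounded (range f)"
  obtains c where "\<And>x. \<bar>f x\<bar> \<le> c"
  using assms unfolding bounded_iff by auto

context
  fixes m :: "('a \<Rightarrow> real) \<Rightarrow> real"
  assumes m: "is_mean m"
begin

lemma mean_add: "bounded (range f) \<Longrightarrow> bounded (range g) \<Longrightarrow> m (\<lambda>x. f x + g x) = m f + m g"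
  and mean_cmult: "bounded (range f) \<Longrightarrow> m (\<lambda>x. c * f x) = c * m f"
  and mean_nonneg: "bounded (range f) \<Longrightarrow> (\<And>x. 0 \<le> f x) \<Longrightarrow> 0 \<le> m f"
  and mean_const: "m (\<lambda>_. c) = c"
proof -
  have "m (\<lambda>_. c * 1) = c * m (\<lambda>_. 1)"
    using m bounded_range_const[of "1::real"] unfolding is_mean_def by blast
  then show "m (\<lambda>_. c) = c" using m by (simp add: is_mean_def)
qed (use m in \<open>auto simp: is_mean_def\<close>)

lemma mean_diff:
  assumes "bounded (range f)" "bounded (range g)"
  shows "m (\<lambda>x. f x - g x) = m f - m g"
proof -
  have "bounded (range (\<lambda>x. - 1 * g x))"
    using assms by (simp add: bounded_iff)
  from mean_add[OF assms(1) this] mean_cmult[OF assms(2), of "- 1"] show ?thesis by simp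
qed

lemma mean_mono:
  assumes "bounded (range f)" "bounded (range g)" "\<And>x. f x \<le> g x"
  shows "m f \<le> m g"
  using mean_nonneg[of "\<lambda>x. g x - f x"] mean_diff[OF assms(2,1)] assms bounded_minus_comp[of g UNIV f]
  by auto

lemma mean_le: "(\<And>x. 0 \<le> f x) \<Longrightarrow> (\<And>x. f x \<le> c) \<Longrightarrow> m f \<le> c"
  using mean_mono[of f "\<lambda>_. c"] mean_const bounded_range_realI[of f c] by (simp add: bounded_range_const)

lemma mean_ge: "bounded (range f) \<Longrightarrow> (\<And>x. c \<le> f x) \<Longrightarrow> c \<le> m f"
  using mean_mono[of "\<lambda>_. c" f] mean_const by (simp add: bounded_range_const)

lemma mean_abs_le:
  assumes "\<And>x. \<bar>f x\<bar> \<le> c"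
  shows "\<bar>m f\<bar> \<le> c"
  using mean_mono[of f "\<lambda>_. c"] mean_mono[of "\<lambda>_. - c" f] mean_const bounded_range_realI[of f c] assms
  by (simp add: bounded_range_const abs_le_iff minus_le_iff)

end

text \<open>Tychonoff's theorem: by \<open>mean_abs_le\<close> a mean sends each \<open>f\<close>
  into the compact interval \<open>{- c f..c f}\<close>, and each axiom of \<open>is_mean\<close> is
  a closed condition on finitely many coordinates.\<close>

lemma compact_means: "compact {m :: ('a \<Rightarrow> real) \<Rightarrow> real. is_mean m}"
proof -
  define c where "c f = (if bounded (range f) then SUP x. \<bar>f x\<bar> else 0)" for f :: "'a \<Rightarrow> real"
  have "compactin (product_topology (\<lambda>_. euclidean) UNIV) (PiE UNIV (\<lambda>f. {- c f..c f}))"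
    unfolding compactin_PiE by simp
  then have "compact (PiE UNIV (\<lambda>f. {- c f..c f}))"
    by (simp add: euclidean_product_topology)
  moreover have "closed {m :: ('a \<Rightarrow> real) \<Rightarrow> real. is_mean m}"
    unfolding is_mean_def
    by (intro closed_Collect_conj closed_Collect_all closed_Collect_imp open_Collect_const
        closed_Collect_eq closed_Collect_le continuous_intros continuous_on_product_coordinates)
  moreover have "m f \<in> {- c f..c f}" if m: "is_mean m" for m f
  proof (cases "bounded (range f)")
    case True
    then obtain C where C: "\<bar>f x\<bar> \<le> C" for x using bounded_range_realE by blast
    then have "bdd_above (range (\<lambda>x. \<bar>f x\<bar>))" by (intro bdd_aboveI) auto
    then have "\<bar>f x\<bar> \<le> c f" for x
      unfolding c_def using True by (auto intro: cSUP_upper)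
    from mean_abs_le[of m f, OF m this] show ?thesis by (simp add: abs_le_iff minus_le_iff)
  next
    case False
    then show ?thesis using m by (simp add: c_def is_mean_def)
  qed
  then have "{m. is_mean m} \<subseteq> PiE UNIV (\<lambda>f. {- c f..c f})" by (auto simp: PiE_iff)
  ultimately show ?thesis
    using compact_Int_closed[of "PiE UNIV (\<lambda>f. {- c f..c f})" "{m. is_mean m}"]
    by (simp add: Int_absorb1)
qed

text \<open>The average of the translates by \<open>0, a, \<dots>, k a\<close> moves by at most \<open>2 c / (k + 1)\<close>
  under translation by \<open>a\<close>.\<close>

lemma mean_almost_invariant:
  fixes S :: "('a::ab_group_add \<times> nat) set"
  assumes "finite S"
  shows "\<exists>m. is_mean m \<and>
    (\<forall>(a, k)\<in>S. \<forall>f c. (\<forall>x. \<bar>f x\<bar> \<le> c) \<longrightarrow> \<bar>m (\<lambda>x. f (x + a)) - m f\<bar> \<le> 2 * c / (real k + 1))"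
  using assms
proof (induction S)
  case empty
  \<comment> \<open>Evaluation at 0; with no pair to satisfy, any mean starts the induction.\<close>
  have "is_mean (\<lambda>f :: 'a \<Rightarrow> real. if bounded (range f) then f 0 else 0)"
    unfolding is_mean_def
    using bounded_plus_comp[where S = UNIV and 'b = real] bounded_scaleR_comp[where S = UNIV and 'b = real]
    by (auto simp: bounded_range_const)
  then show ?case by blast
next
  case (insert p S)
  obtain a k where p: "p = (a, k)" by force
  from insert obtain m where m: "is_mean m"
    and inv: "\<And>b l f c. (b, l) \<in> S \<Longrightarrow> (\<And>x. \<bar>f x\<bar> \<le> c) \<Longrightarrow>
      \<bar>m (\<lambda>x. f (x + b)) - m f\<bar> \<le> 2 * c / (real l + 1)"
    by blast
  \<comment> \<open>The multiple i a, written as an iterated sum because the group carries no scalar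
    multiplication.\<close>
  define \<tau> where "\<tau> i = ((+) a ^^ i) (0 :: 'a)" for i
  have \<tau>: "\<tau> 0 = 0" "\<tau> (Suc i) = \<tau> i + a" for i by (simp_all add: \<tau>_def add.commute)
  define A where "A f x = (\<Sum>i\<le>k. f (x + \<tau> i)) / (real k + 1)" for f :: "'a \<Rightarrow> real" and x
  have bA: "\<bar>A f x\<bar> \<le> c" if "\<And>x. \<bar>f x\<bar> \<le> c" for f c x
  proof -
    have "\<bar>\<Sum>i\<le>k. f (x + \<tau> i)\<bar> \<le> (\<Sum>i\<le>k. c)"
      by (rule order_trans[OF sum_abs sum_mono]) (use that in auto)
    then show ?thesis by (simp add: A_def divide_le_eq mult.commute algebra_simps)
  qed
  have bA': "bounded (range (A f))" if "bounded (range f)" for f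
    using bA bounded_range_realI bounded_range_realE[OF that] by metis
  \<comment> \<open>In an abelian group averaging commutes with translation, and it does not
    increase a uniform bound. Hence the estimates already obtained for \<open>S\<close> pass from
    \<open>m\<close> to \<open>m'\<close>.\<close>
  define m' where "m' f = (if bounded (range f) then m (A f) else 0)" for f
  have "is_mean m'"
    unfolding is_mean_def
  proof (intro conjI allI impI)
    fix f g :: "'a \<Rightarrow> real" assume fg: "bounded (range f)" "bounded (range g)"
    have "A (\<lambda>x. f x + g x) = (\<lambda>x. A f x + A g x)"
      by (simp add: A_def fun_eq_iff sum.distrib add_divide_distrib)
    then show "m' (\<lambda>x. f x + g x) = m' f + m' g"
      using fg by (simp add: m'_def bounded_plus_comp mean_add[OF m] bA')
  next
    fix c f assume f: "bounded (range (f :: 'a \<Rightarrow> real))"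
    have "A (\<lambda>x. c * f x) = (\<lambda>x. c * A f x)"
      by (simp add: A_def fun_eq_iff sum_distrib_left)
    moreover have "bounded (range (\<lambda>x. c * f x))"
      using bounded_scaleR_comp[OF f] by simp
    ultimately show "m' (\<lambda>x. c * f x) = c * m' f"
      using f by (simp add: m'_def mean_cmult[OF m] bA')
  next
    fix f assume "bounded (range (f :: 'a \<Rightarrow> real))" "\<forall>x. 0 \<le> f x"
    then show "0 \<le> m' f"
      by (auto simp: m'_def bA' A_def intro!: mean_nonneg[OF m] sum_nonneg divide_nonneg_nonneg)
        (use bA' in \<open>auto simp: A_def[abs_def]\<close>)
  next
    have "A (\<lambda>_. 1) = (\<lambda>_. 1)" by (simp add: A_def fun_eq_iff)
    then show "m' (\<lambda>_. 1) = 1" using mean_const[OF m] by (simp add: m'_def bounded_range_const)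
  qed (simp add: m'_def)
  moreover have "\<bar>m' (\<lambda>x. f (x + b)) - m' f\<bar> \<le> 2 * c / (real l + 1)"
    if bl: "(b, l) \<in> insert p S" and f: "\<And>x. \<bar>f x\<bar> \<le> c" for b l f c
  proof -
    have bf: "bounded (range f)" "bounded (range (\<lambda>x. f (x + b)))"
      using f by (auto intro: bounded_range_realI)
    have At: "A (\<lambda>x. f (x + b)) = (\<lambda>x. A f (x + b))"
      by (simp add: A_def fun_eq_iff ac_simps)
    consider "(b, l) \<in> S" | "b = a" "l = k" using bl p by auto
    then show ?thesis
    proof cases
      case 1
      have "\<bar>m (\<lambda>x. A f (x + b)) - m (A f)\<bar> \<le> 2 * c / (real l + 1)"
        using inv[OF 1, of "A f" c] bA[of f c] f by blast
      then show ?thesis by (simp add: m'_def bf At)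
    next
      case 2
      have "\<bar>A f (x + a) - A f x\<bar> \<le> 2 * c / (real k + 1)" for x
      proof -
        have "(\<Sum>i\<le>k. f (x + a + \<tau> i)) - (\<Sum>i\<le>k. f (x + \<tau> i)) =
            (\<Sum>i\<le>k. f (x + \<tau> (Suc i)) - f (x + \<tau> i))"
          by (simp add: \<tau> sum_subtractf ac_simps)
        also have "\<dots> = f (x + \<tau> (Suc k)) - f (x + \<tau> 0)"
          using sum_lessThan_telescope[of "\<lambda>i. f (x + \<tau> i)" "Suc k"] by (simp add: lessThan_Suc_atMost)
        finally have "\<bar>(\<Sum>i\<le>k. f (x + a + \<tau> i)) - (\<Sum>i\<le>k. f (x + \<tau> i))\<bar> \<le> 2 * c"
          using f[of "x + \<tau> (Suc k)"] f[of "x + \<tau> 0"] by linarith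
        then show ?thesis
          by (simp add: A_def diff_divide_distrib[symmetric] divide_right_mono)
      qed
      from mean_abs_le[of m "\<lambda>x. A f (x + a) - A f x", OF m this] show ?thesis
        using 2 bf bA'[OF bf(1)] bA'[OF bf(2)] At
        by (simp add: m'_def mean_diff[OF m])
    qed
  qed
  ultimately show ?case by blast
qed

text \<open>Any finite set of almost-invariance conditions can be met by one mean. Each condition is
  closed, so compactness meets all pairs (a, k) at once, and letting k grow with \<open>a\<close>
  fixed forces exact invariance.\<close>

lemma invariant_mean_exists:
  "\<exists>m :: ('a::ab_group_add \<Rightarrow> real) \<Rightarrow> real. is_mean m \<and>
     (\<forall>f a. bounded (range f) \<longrightarrow> m (\<lambda>x. f (x + a)) = m f)"
proof -
  define C where "C p = {m :: ('a \<Rightarrow> real) \<Rightarrow> real. case p of (a, k) \<Rightarrow>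
    \<forall>f c. (\<forall>x. \<bar>f x\<bar> \<le> c) \<longrightarrow> \<bar>m (\<lambda>x. f (x + a)) - m f\<bar> \<le> 2 * c / (real k + 1)}" for p
  have "{m. is_mean m} \<inter> (\<Inter>p\<in>UNIV. C p) \<noteq> {}"
  proof (rule compact_imp_fip_image[OF compact_means])
    show "closed (C p)" for p :: "'a \<times> nat"
      unfolding C_def case_prod_beta
      by (intro closed_Collect_all closed_Collect_imp open_Collect_const
          closed_Collect_le continuous_intros continuous_on_product_coordinates)
    show "{m. is_mean m} \<inter> (\<Inter>p\<in>S. C p) \<noteq> {}" if fin: "finite S" for S
    proof -
      obtain m where "is_mean m" "\<forall>(a, k)\<in>S. \<forall>f c. (\<forall>x. \<bar>f x\<bar> \<le> c) \<longrightarrow>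
          \<bar>m (\<lambda>x. f (x + a)) - m f\<bar> \<le> 2 * c / (real k + 1)"
        using mean_almost_invariant[OF fin] by blast
      then have "m \<in> {m. is_mean m} \<inter> (\<Inter>p\<in>S. C p)" by (auto simp: C_def)
      then show ?thesis by blast
    qed
  qed
  then obtain m where m: "is_mean m" and mC: "m \<in> C p" for p by auto
  have "m (\<lambda>x. f (x + a)) = m f" if f: "bounded (range f)" for f a
  proof -
    obtain c where c: "\<bar>f x\<bar> \<le> c" for x using bounded_range_realE[OF f] by blast
    have *: "\<bar>m (\<lambda>x. f (x + a)) - m f\<bar> \<le> 2 * c / real (Suc k)" for k
      using mC[of "(a, k)"] c unfolding C_def by (simp add: add.commute)
    have "(\<lambda>k. 2 * c / real (Suc k)) \<longlonglongrightarrow> 0"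
      by (rule filterlim_compose[OF _ filterlim_Suc, of "\<lambda>k. 2 * c / real k"]) (rule lim_const_over_n)
    from LIMSEQ_le_const[OF this] * have "\<bar>m (\<lambda>x. f (x + a)) - m f\<bar> \<le> 0" by blast
    then show ?thesis by simp
  qed
  with m show ?thesis by blast
qed

subsection \<open>Uniform convexity as a quadratic inequality\<close>

text \<open>Write S for the sum of the two squares and D for the defect in the last bracket; D \<ge>
  0 by convexity. If the squared distance is at most \<epsilon> S, the first term suffices.
  Otherwise D \<ge> c S: either the two lengths differ substantially and D gains the square of half
  their difference, or they are comparable and uniform convexity applies to the normalized vectors.
  Then 2/c is a valid constant, since the squared distance never exceeds 2 S.\<close>

lemma uniformly_convex_defect:
  fixes N :: "'b::real_normed_vector \<Rightarrow> real"
  assumes N: "is_norm type_space N" and uc: "uniformly_convex_norm type_space N" and "\<epsilon> > 0"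
  obtains C where "C > 0"
    "\<And>x y. (N (x - y))\<^sup>2 \<le> \<epsilon> * ((N x)\<^sup>2 + (N y)\<^sup>2) +
       C * (((N x)\<^sup>2 + (N y)\<^sup>2) / 2 - (N ((1/2) *\<^sub>R (x + y)))\<^sup>2)"
proof -
  have nn: "N x \<ge> 0" and n0: "N x = 0 \<longleftrightarrow> x = 0" and tri: "N (x + y) \<le> N x + N y"
    and sc: "N (a *\<^sub>R x) = \<bar>a\<bar> * N x" for x y a
    using N by (auto simp: is_norm_def)
  have tri': "N (x - y) \<le> N x + N y" for x y
    using tri[of x "(-1) *\<^sub>R y"] sc[of "-1" y] by simp
  \<comment> \<open>Below, a \<ge> b are the lengths of x and y. The bound 1/2 forces b \<ge> a/2
    once a - b < \<eta> a. The bound sqrt \<epsilon> / 2 leaves the normalized vectors \<eta> apart,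
    because normalizing costs at most \<eta> a of a distance of at least sqrt \<epsilon> a.\<close>
  define \<eta> where "\<eta> = min (1/2) (sqrt \<epsilon> / 2)"
  have \<eta>: "0 < \<eta>" "\<eta> \<le> 1/2" "2 * \<eta> \<le> sqrt \<epsilon>" using \<open>\<epsilon> > 0\<close> by (auto simp: \<eta>_def)
  obtain \<delta>0 where \<delta>0: "\<delta>0 > 0" "\<And>x y. N x = 1 \<Longrightarrow> N y = 1 \<Longrightarrow> N (x - y) \<ge> \<eta> \<Longrightarrow>
      N ((1/2) *\<^sub>R (x + y)) \<le> 1 - \<delta>0"
    using uc \<eta>(1) unfolding uniformly_convex_norm_def vdiff_def by auto
  \<comment> \<open>The cap at 1 gives b \<delta> \<le> b, hence a + b - b \<delta> \<ge> a in the
    final estimate.\<close>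
  define \<delta> where "\<delta> = min 1 \<delta>0"
  have \<delta>: "0 < \<delta>" "\<delta> \<le> 1" "\<And>x y. N x = 1 \<Longrightarrow> N y = 1 \<Longrightarrow> N (x - y) \<ge> \<eta> \<Longrightarrow>
      N ((1/2) *\<^sub>R (x + y)) \<le> 1 - \<delta>"
  proof -
    show "0 < \<delta>" "\<delta> \<le> 1" using \<delta>0(1) by (auto simp: \<delta>_def)
    show "N ((1/2) *\<^sub>R (x + y)) \<le> 1 - \<delta>"
      if "N x = 1" "N y = 1" "N (x - y) \<ge> \<eta>" for x y
      using \<delta>0(2)[OF that] by (simp add: \<delta>_def)
  qed
  \<comment> \<open>The two cases gain (\<eta> a / 2)^2 and \<delta> a^2 / 2 respectively, each to
    be compared with c S, where S \<le> 2 a^2.\<close>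
  define c where "c = min (\<eta>\<^sup>2 / 8) (\<delta> / 8)"
  have c: "c > 0" "c \<le> \<eta>\<^sup>2 / 8" "c \<le> \<delta> / 8" using \<eta> \<delta> by (auto simp: c_def)
  have mid: "N ((1/2) *\<^sub>R (x + y)) \<le> (N x + N y) / 2" for x y
    using tri[of x y] sc[of "1/2" "x + y"] by simp
  have par: "((a + b) / 2)\<^sup>2 = (a\<^sup>2 + b\<^sup>2) / 2 - ((a - b) / 2)\<^sup>2" for a b :: real
    by (simp add: power2_eq_square field_simps)
  have key: "(N ((1/2) *\<^sub>R (x + y)))\<^sup>2 \<le> ((N x)\<^sup>2 + (N y)\<^sup>2) / 2 - c * ((N x)\<^sup>2 + (N y)\<^sup>2)"
    if le: "N y \<le> N x" and far: "(N (x - y))\<^sup>2 > \<epsilon> * ((N x)\<^sup>2 + (N y)\<^sup>2)" for x y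
  proof -
    define a b where "a = N x" and "b = N y"
    have ab: "0 \<le> b" "b \<le> a" using nn le by (auto simp: a_def b_def)
    have "a \<noteq> 0" using far ab n0[of x] n0[of y] by (auto simp: a_def b_def)
    then have a: "a > 0" using ab by simp
    have sq: "a\<^sup>2 + b\<^sup>2 \<le> 2 * a\<^sup>2" using ab by (simp add: power_mono)
    have mono: "(N ((1/2) *\<^sub>R (x + y)))\<^sup>2 \<le> s\<^sup>2" if "N ((1/2) *\<^sub>R (x + y)) \<le> s" for s
      using that nn by (simp add: power_mono)
    show ?thesis
    proof (cases "a - b \<ge> \<eta> * a")
      case True
      have "c * (a\<^sup>2 + b\<^sup>2) \<le> \<eta>\<^sup>2 / 8 * (2 * a\<^sup>2)"
        using c sq by (intro mult_mono) auto
      also have "\<dots> = (\<eta> * a / 2)\<^sup>2" by (simp add: power2_eq_square)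
      also have "\<dots> \<le> ((a - b) / 2)\<^sup>2"
        using True \<eta> a by (intro power_mono) auto
      finally show ?thesis
        using mono[OF mid] par[of a b] by (simp add: a_def b_def)
    next
      case False
      have "b \<ge> a / 2" using False \<eta>(2) mult_right_mono[OF \<eta>(2), of a] a by linarith
      then have b: "b > 0" using a by simp
      define x' y' where "x' = (1/a) *\<^sub>R x" and "y' = (1/b) *\<^sub>R y"
      have xy: "x = a *\<^sub>R x'" "y = b *\<^sub>R y'" using a b by (auto simp: x'_def y'_def)
      have u: "N x' = 1" "N y' = 1" using a b by (auto simp: x'_def y'_def sc a_def b_def)
      have "sqrt \<epsilon> * a = sqrt (\<epsilon> * a\<^sup>2)" using a by (simp add: real_sqrt_mult)
      also have "\<dots> \<le> sqrt ((N (x - y))\<^sup>2)"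
      proof (rule real_sqrt_le_mono)
        have "0 \<le> \<epsilon> * (N y)\<^sup>2" using \<open>\<epsilon> > 0\<close> by simp
        then show "\<epsilon> * a\<^sup>2 \<le> (N (x - y))\<^sup>2"
          using far unfolding a_def distrib_left by linarith
      qed
      also have "\<dots> = N (x - y)" using nn by simp
      also have "x - y = a *\<^sub>R (x' - y') + (a - b) *\<^sub>R y'"
        by (simp add: xy algebra_simps)
      also have "N \<dots> \<le> a * N (x' - y') + (a - b)"
        using tri[of "a *\<^sub>R (x' - y')" "(a - b) *\<^sub>R y'"] a ab u by (simp add: sc)
      finally have "sqrt \<epsilon> * a \<le> a * N (x' - y') + \<eta> * a" using False by linarith
      then have "2 * \<eta> * a \<le> a * N (x' - y') + \<eta> * a"
        using mult_right_mono[OF \<eta>(3), of a] a by linarith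
      then have "\<eta> \<le> N (x' - y')" using a by (simp add: algebra_simps)
      from \<delta>(3)[OF u this] have m: "N ((1/2) *\<^sub>R (x' + y')) \<le> 1 - \<delta>" .
      \<comment> \<open>The convexity gain applies to the common length b; the excess along x' costs
        no more than its length (a - b)/2.\<close>
      have "(1/2) *\<^sub>R (x + y) = b *\<^sub>R ((1/2) *\<^sub>R (x' + y')) + ((a - b)/2) *\<^sub>R x'"
        by (simp add: xy scaleR_right_distrib scaleR_left_diff_distrib diff_divide_distrib)
      then have "N ((1/2) *\<^sub>R (x + y)) \<le> b * N ((1/2) *\<^sub>R (x' + y')) + (a - b)/2"
        using tri[of "b *\<^sub>R ((1/2) *\<^sub>R (x' + y'))" "((a - b)/2) *\<^sub>R x'"] b ab u
        by (simp only: sc) simp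
      also have "\<dots> \<le> b * (1 - \<delta>) + (a - b) / 2" using m b by simp
      also have "\<dots> = (a + b) / 2 - b * \<delta>" by (simp add: field_simps)
      finally have "(N ((1/2) *\<^sub>R (x + y)))\<^sup>2 \<le> ((a + b) / 2 - b * \<delta>)\<^sup>2" by (rule mono)
      also have "\<dots> = ((a + b) / 2)\<^sup>2 - b * \<delta> * (a + b - b * \<delta>)"
        by (simp add: power2_eq_square algebra_simps add_divide_distrib)
      also have "\<dots> \<le> ((a + b) / 2)\<^sup>2 - (a / 2) * \<delta> * a"
      proof -
        have "b * \<delta> \<le> b" using \<delta> b by (simp add: mult_left_le)
        then have "(a / 2) * \<delta> * a \<le> b * \<delta> * (a + b - b * \<delta>)"
          using \<open>b \<ge> a / 2\<close> a b \<delta> by (intro mult_mono) auto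
        then show ?thesis by simp
      qed
      also have "(a / 2) * \<delta> * a = \<delta> / 4 * (2 * a\<^sup>2)" by (simp add: power2_eq_square)
      also have "((a + b) / 2)\<^sup>2 - \<delta> / 4 * (2 * a\<^sup>2) \<le> (a\<^sup>2 + b\<^sup>2) / 2 - c * (a\<^sup>2 + b\<^sup>2)"
      proof -
        have "c * (a\<^sup>2 + b\<^sup>2) \<le> \<delta> / 4 * (2 * a\<^sup>2)"
          using c \<delta> sq by (intro mult_mono) auto
        then show ?thesis using par[of a b] zero_le_power2[of "(a - b)/2"] by linarith
      qed
      finally show ?thesis by (simp add: a_def b_def)
    qed
  qed
  have "(N (x - y))\<^sup>2 \<le> \<epsilon> * ((N x)\<^sup>2 + (N y)\<^sup>2) +
       (2 / c) * (((N x)\<^sup>2 + (N y)\<^sup>2) / 2 - (N ((1/2) *\<^sub>R (x + y)))\<^sup>2)" for x y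
  proof -
    define S D where "S = (N x)\<^sup>2 + (N y)\<^sup>2" and "D = S / 2 - (N ((1/2) *\<^sub>R (x + y)))\<^sup>2"
    have "(N ((1/2) *\<^sub>R (x + y)))\<^sup>2 \<le> ((N x + N y) / 2)\<^sup>2"
      using mid nn by (intro power_mono) auto
    then have D0: "D \<ge> 0"
      using par[of "N x" "N y"] zero_le_power2[of "(N x - N y)/2"] unfolding D_def S_def by linarith
    have S0: "S \<ge> 0" by (simp add: S_def)
    have "(N (x - y))\<^sup>2 \<le> \<epsilon> * S + (2 / c) * D"
    proof (cases "(N (x - y))\<^sup>2 \<le> \<epsilon> * S")
      case True
      moreover have "(2 / c) * D \<ge> 0" using D0 c by simp
      ultimately show ?thesis by linarith
    next
      case False
      have "N (y - x) = N (x - y)" using sc[of "-1" "x - y"] by simp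
      then have "D \<ge> c * S"
        using key[of y x] key[of x y] False unfolding D_def S_def
        by (cases "N y \<le> N x") (auto simp: add.commute)
      then have "(2 / c) * D \<ge> (2 / c) * (c * S)"
        using c by (intro mult_left_mono) auto
      then have "2 * S \<le> (2 / c) * D" using c by simp
      moreover have "(N (x - y))\<^sup>2 \<le> (N x + N y)\<^sup>2"
        using tri' nn by (intro power_mono) auto
      moreover have "(N x + N y)\<^sup>2 \<le> 2 * S"
        using zero_le_power2[of "N x - N y"] by (simp add: S_def power2_eq_square algebra_simps)
      moreover have "\<epsilon> * S \<ge> 0" using S0 \<open>\<epsilon> > 0\<close> by simp
      ultimately show ?thesis by linarith
    qed
    then show ?thesis by (simp add: D_def S_def)
  qed
  then show ?thesis using that[of "2 / c"] c by simp
qed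

text \<open>Converse of the previous lemma, for an arbitrary carrier. Applied with \<epsilon>^2 / 4,
  the first term takes up only \<epsilon>^2 / 2 on unit vectors, so the defect must account for the
  other half.\<close>

lemma uniformly_convex_normI:
  assumes def: "\<And>\<epsilon>. \<epsilon> > 0 \<Longrightarrow> \<exists>C>0. \<forall>x\<in>car V. \<forall>y\<in>car V.
       (N (vdiff V x y))\<^sup>2 \<le> \<epsilon> * ((N x)\<^sup>2 + (N y)\<^sup>2) +
       C * (((N x)\<^sup>2 + (N y)\<^sup>2) / 2 - (N (scl V (1/2) (plu V x y)))\<^sup>2)"
  shows "uniformly_convex_norm V N"
  unfolding uniformly_convex_norm_def
proof (intro allI impI)
  fix \<epsilon> :: real assume \<epsilon>: "\<epsilon> > 0"
  then have "\<epsilon>\<^sup>2 / 4 > 0" by simp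
  from def[OF this] obtain C where C: "C > 0" "\<forall>x\<in>car V. \<forall>y\<in>car V.
       (N (vdiff V x y))\<^sup>2 \<le> \<epsilon>\<^sup>2 / 4 * ((N x)\<^sup>2 + (N y)\<^sup>2) +
       C * (((N x)\<^sup>2 + (N y)\<^sup>2) / 2 - (N (scl V (1/2) (plu V x y)))\<^sup>2)"
    by (elim exE conjE)
  \<comment> \<open>Half of the lower bound obtained for 1 - M^2, because (1 - \<delta>)^2 \<ge> 1 -
    2 \<delta>; the cap at 1 keeps 1 - \<delta> nonnegative when the square root is taken.\<close>
  define \<delta> where "\<delta> = min 1 (\<epsilon>\<^sup>2 / (4 * C))"
  have \<delta>: "0 < \<delta>" "\<delta> \<le> 1" "\<delta> \<le> \<epsilon>\<^sup>2 / (4 * C)" using \<epsilon> C(1) by (auto simp: \<delta>_def)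
  show "\<exists>\<delta>>0. \<forall>x\<in>car V. \<forall>y\<in>car V. N x = 1 \<longrightarrow> N y = 1 \<longrightarrow> \<epsilon> \<le> N (vdiff V x y) \<longrightarrow>
      N (scl V (1/2) (plu V x y)) \<le> 1 - \<delta>"
  proof (intro exI[of _ \<delta>] conjI ballI impI)
    fix x y assume xy: "x \<in> car V" "y \<in> car V" "N x = 1" "N y = 1" "\<epsilon> \<le> N (vdiff V x y)"
    define M where "M = N (scl V (1/2) (plu V x y))"
    have "\<epsilon>\<^sup>2 \<le> (N (vdiff V x y))\<^sup>2" using xy(5) \<epsilon> by (intro power_mono) auto
    also have "\<dots> \<le> \<epsilon>\<^sup>2 / 2 + C * (1 - M\<^sup>2)" using C(2)[rule_format, OF xy(1,2)] by (simp add: M_def xy(3,4))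
    finally have "\<epsilon>\<^sup>2 / 2 \<le> C * (1 - M\<^sup>2)" by simp
    then have "\<epsilon>\<^sup>2 / 2 / C \<le> 1 - M\<^sup>2" using C(1) by (simp add: divide_le_eq mult.commute)
    moreover have "\<epsilon>\<^sup>2 / 2 / C = 2 * (\<epsilon>\<^sup>2 / (4 * C))" by simp
    ultimately have "2 * (\<epsilon>\<^sup>2 / (4 * C)) \<le> 1 - M\<^sup>2" by simp
    then have "M\<^sup>2 \<le> 1 - 2 * \<delta>" using \<delta> by linarith
    also have "\<dots> \<le> (1 - \<delta>)\<^sup>2" by (simp add: power2_eq_square algebra_simps)
    finally show "N (scl V (1/2) (plu V x y)) \<le> 1 - \<delta>"
      unfolding M_def by (rule power2_le_imp_le) (use \<delta>(2) in simp)
  qed (rule \<delta>)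
qed

subsection \<open>Completion of a separable seminormed space\<close>

text \<open>\<open>N\<close> may vanish on nonzero vectors, so completing also means dividing by its
  kernel. Nothing is assumed about \<open>N\<close> off \<open>W\<close>: in the application it is
  there the root of a possibly divergent series.\<close>

locale separable_seminorm =
  fixes W :: "'u::real_vector set" and N :: "'u \<Rightarrow> real" and d :: "nat \<Rightarrow> 'u"
  assumes W: "subspace W"
    and N_triangle: "x \<in> W \<Longrightarrow> y \<in> W \<Longrightarrow> N (x + y) \<le> N x + N y"
    and N_scale: "x \<in> W \<Longrightarrow> N (a *\<^sub>R x) = \<bar>a\<bar> * N x"
    and d_in: "d k \<in> W"
    and d_dense: "x \<in> W \<Longrightarrow> e > 0 \<Longrightarrow> \<exists>k. N (x - d k) < e"
begin

lemma W_closed [simp, intro]: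
  "0 \<in> W" "x \<in> W \<Longrightarrow> y \<in> W \<Longrightarrow> x + y \<in> W" "x \<in> W \<Longrightarrow> y \<in> W \<Longrightarrow> x - y \<in> W"
  "x \<in> W \<Longrightarrow> a *\<^sub>R x \<in> W" "d k \<in> W"
  using W d_in by (auto intro: subspace_0 subspace_add subspace_diff subspace_scale)

lemma N_0 [simp]: "N 0 = 0"
  using N_scale[of 0 0] by simp

lemma N_minus_commute: "x \<in> W \<Longrightarrow> y \<in> W \<Longrightarrow> N (x - y) = N (y - x)"
  using N_scale[of "y - x" "-1"] by simp

lemma N_triangle_diff:
  assumes "x \<in> W" "y \<in> W" "z \<in> W"
  shows "N (x - z) \<le> N (x - y) + N (y - z)"
  using N_triangle[of "x - y" "y - z"] assms by simp

lemma N_nonneg: "x \<in> W \<Longrightarrow> 0 \<le> N x"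
  using N_triangle_diff[of x 0 x] N_minus_commute[of x 0] by simp

lemma N_abs_diff:
  assumes "x \<in> W" "y \<in> W"
  shows "\<bar>N x - N y\<bar> \<le> N (x - y)"
  using N_triangle[of "x - y" y] N_triangle[of "y - x" x] N_minus_commute[of x y] assms by auto

section \<open>Cauchy sequences and their limit norms\<close>

definition cauchy_seqs :: "(nat \<Rightarrow> 'u) set" where
  "cauchy_seqs = {s. range s \<subseteq> W \<and> (\<forall>e>0. \<exists>K. \<forall>m\<ge>K. \<forall>n\<ge>K. N (s m - s n) < e)}"

lemma cauchy_seqs_in [simp]: "s \<in> cauchy_seqs \<Longrightarrow> s n \<in> W"
  by (auto simp: cauchy_seqs_def)

lemma cauchy_seqsD: "s \<in> cauchy_seqs \<Longrightarrow> e > 0 \<Longrightarrow> \<exists>K. \<forall>m\<ge>K. \<forall>n\<ge>K. N (s m - s n) < e"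
  by (auto simp: cauchy_seqs_def)

lemma cauchy_seqs_const [simp, intro]: "w \<in> W \<Longrightarrow> (\<lambda>_. w) \<in> cauchy_seqs"
  by (auto simp: cauchy_seqs_def)

lemma cauchy_seqs_add [simp, intro]:
  assumes s: "s \<in> cauchy_seqs" and t: "t \<in> cauchy_seqs"
  shows "(\<lambda>n. s n + t n) \<in> cauchy_seqs"
  unfolding cauchy_seqs_def
proof (intro CollectI conjI allI impI)
  fix e :: real assume "e > 0"
  then obtain K L where K: "\<forall>m\<ge>K. \<forall>n\<ge>K. N (s m - s n) < e/2" and L: "\<forall>m\<ge>L. \<forall>n\<ge>L. N (t m - t n) < e/2"
    using cauchy_seqsD[OF s, of "e/2"] cauchy_seqsD[OF t, of "e/2"] by auto
  have "N (s m + t m - (s n + t n)) < e" if "m \<ge> max K L" "n \<ge> max K L" for m n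
  proof -
    have "N (s m - s n) < e/2" "N (t m - t n) < e/2" using K L that by auto
    then show ?thesis
      using N_triangle[of "s m - s n" "t m - t n"] s t by (simp add: algebra_simps)
  qed
  then show "\<exists>K. \<forall>m\<ge>K. \<forall>n\<ge>K. N (s m + t m - (s n + t n)) < e" by blast
qed (use s t in auto)

lemma cauchy_seqs_scale [simp, intro]:
  assumes s: "s \<in> cauchy_seqs"
  shows "(\<lambda>n. a *\<^sub>R s n) \<in> cauchy_seqs"
  unfolding cauchy_seqs_def
proof (intro CollectI conjI allI impI)
  fix e :: real assume "e > 0"
  then obtain K where K: "\<forall>m\<ge>K. \<forall>n\<ge>K. N (s m - s n) < e / (\<bar>a\<bar> + 1)"
    using cauchy_seqsD[OF s, of "e / (\<bar>a\<bar> + 1)"] by auto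
  have "N (a *\<^sub>R s m - a *\<^sub>R s n) < e" if "m \<ge> K" "n \<ge> K" for m n
  proof -
    have "N (s m - s n) < e / (\<bar>a\<bar> + 1)" using K that by auto
    then have "N (s m - s n) * (\<bar>a\<bar> + 1) < e" by (simp add: less_divide_eq)
    then have "\<bar>a\<bar> * N (s m - s n) < e"
      using N_nonneg[of "s m - s n"] s by (simp add: algebra_simps)
    then show ?thesis using N_scale[of "s m - s n" a] s by (simp add: algebra_simps)
  qed
  then show "\<exists>K. \<forall>m\<ge>K. \<forall>n\<ge>K. N (a *\<^sub>R s m - a *\<^sub>R s n) < e" by blast
qed (use s in auto)

lemma cauchy_seqs_diff [simp, intro]:
  "s \<in> cauchy_seqs \<Longrightarrow> t \<in> cauchy_seqs \<Longrightarrow> (\<lambda>n. s n - t n) \<in> cauchy_seqs"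
  using cauchy_seqs_add[of s "\<lambda>n. (-1) *\<^sub>R t n"] cauchy_seqs_scale[of t "-1"] by simp

lemma cauchy_seqs_convergent:
  assumes s: "s \<in> cauchy_seqs"
  shows "convergent (\<lambda>n. N (s n))"
proof (rule Cauchy_convergent, rule CauchyI)
  fix e :: real assume "e > 0"
  from cauchy_seqsD[OF s this] obtain K where K: "\<forall>m\<ge>K. \<forall>n\<ge>K. N (s m - s n) < e" ..
  have "norm (N (s m) - N (s n)) < e" if "m \<ge> K" "n \<ge> K" for m n
  proof -
    have "N (s m - s n) < e" using K that by blast
    then show ?thesis using N_abs_diff[of "s m" "s n"] s by simp
  qed
  then show "\<exists>M. \<forall>m\<ge>M. \<forall>n\<ge>M. norm (N (s m) - N (s n)) < e" by blast
qed

definition lim_norm :: "(nat \<Rightarrow> 'u) \<Rightarrow> real" where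
  "lim_norm s = lim (\<lambda>n. N (s n))"

lemma lim_norm: "s \<in> cauchy_seqs \<Longrightarrow> (\<lambda>n. N (s n)) \<longlonglongrightarrow> lim_norm s"
  using cauchy_seqs_convergent by (simp add: lim_norm_def convergent_LIMSEQ_iff)

lemma lim_norm_nonneg: "s \<in> cauchy_seqs \<Longrightarrow> 0 \<le> lim_norm s"
  using LIMSEQ_le_const[OF lim_norm] N_nonneg by simp

lemma lim_norm_const [simp]: "lim_norm (\<lambda>_. w) = N w"
  by (simp add: lim_norm_def)

lemma lim_norm_tail:
  assumes s: "s \<in> cauchy_seqs" and "e > 0"
  shows "\<exists>K. \<forall>k\<ge>K. lim_norm (\<lambda>n. s n - s k) \<le> e"
proof -
  from cauchy_seqsD[OF s \<open>e > 0\<close>] obtain K where K: "\<forall>m\<ge>K. \<forall>n\<ge>K. N (s m - s n) < e" ..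
  have "lim_norm (\<lambda>n. s n - s k) \<le> e" if "k \<ge> K" for k
    by (rule LIMSEQ_le_const2[OF lim_norm]) (use s K that in \<open>auto intro!: exI[of _ K] less_imp_le\<close>)
  then show ?thesis by blast
qed

text \<open>A point of the completion is encoded by its distances to the dense sequence \<open>d\<close>.\<close>

definition code :: "(nat \<Rightarrow> 'u) \<Rightarrow> nat \<Rightarrow> real" where
  "code s k = lim_norm (\<lambda>n. s n - d k)"

text \<open>If the codes agree, the distance between the two limits is at most twice the distance
  from the first limit to \<open>d k\<close>, for every k, and density makes the latter arbitrarily
  small. The other direction is the reverse triangle inequality. Thus codes are in bijection with
  the points of the Hausdorff completion.\<close>

lemma code_eq_iff:
  assumes s: "s \<in> cauchy_seqs" and t: "t \<in> cauchy_seqs"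
  shows "code s = code t \<longleftrightarrow> lim_norm (\<lambda>n. s n - t n) = 0"
proof
  assume eq: "code s = code t"
  have le: "lim_norm (\<lambda>n. s n - t n) \<le> 2 * code s k" for k
  proof -
    have "lim_norm (\<lambda>n. s n - t n) \<le> code s k + code t k"
      unfolding code_def
    proof (rule LIMSEQ_le[OF lim_norm tendsto_add[OF lim_norm lim_norm]])
      show "\<exists>K. \<forall>n\<ge>K. N (s n - t n) \<le> N (s n - d k) + N (t n - d k)"
        using N_triangle_diff[of "s _" "d k" "t _"] N_minus_commute[of "d k" "t _"] s t by auto
    qed (use s t in auto)
    then show ?thesis using eq by simp
  qed
  have "lim_norm (\<lambda>n. s n - t n) \<le> 0 + e" if e: "e > 0" for e
  proof -
    obtain K where K: "lim_norm (\<lambda>n. s n - s K) \<le> e/4"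
      using lim_norm_tail[OF s divide_pos_pos[OF e zero_less_numeral]] by blast
    obtain k where k: "N (s K - d k) < e/4" using d_dense[of "s K" "e/4"] s e by auto
    have "code s k \<le> lim_norm (\<lambda>n. s n - s K) + N (s K - d k)"
      unfolding code_def
    proof (rule LIMSEQ_le[OF lim_norm tendsto_add[OF lim_norm tendsto_const]])
      show "\<exists>M. \<forall>n\<ge>M. N (s n - d k) \<le> N (s n - s K) + N (s K - d k)"
        using N_triangle_diff[of "s _" "s K" "d k"] s by auto
    qed (use s in auto)
    then show ?thesis using le[of k] K k by simp
  qed
  then have "lim_norm (\<lambda>n. s n - t n) \<le> 0" by (rule field_le_epsilon)
  then show "lim_norm (\<lambda>n. s n - t n) = 0"
    using lim_norm_nonneg[of "\<lambda>n. s n - t n"] s t by simp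
next
  assume 0: "lim_norm (\<lambda>n. s n - t n) = 0"
  show "code s = code t"
  proof
    fix k
    have "(\<lambda>n. N (s n - d k) - N (t n - d k)) \<longlonglongrightarrow> 0"
    proof (rule Lim_null_comparison)
      show "(\<lambda>n. N (s n - t n)) \<longlonglongrightarrow> 0" using lim_norm[of "\<lambda>n. s n - t n"] s t 0 by simp
      show "\<forall>\<^sub>F n in sequentially. norm (N (s n - d k) - N (t n - d k)) \<le> N (s n - t n)"
        using N_abs_diff[of "s _ - d k" "t _ - d k"] s t by simp
    qed
    moreover have "(\<lambda>n. N (s n - d k) - N (t n - d k)) \<longlonglongrightarrow> code s k - code t k"
      unfolding code_def by (intro tendsto_diff lim_norm) (use s t in auto)
    ultimately show "code s k = code t k" using LIMSEQ_unique by fastforce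
  qed
qed

text \<open>A representative of a code. The operations on codes are defined through it, and the
  lemmas below show that any other representative gives the same result.\<close>

definition pick :: "(nat \<Rightarrow> real) \<Rightarrow> nat \<Rightarrow> 'u" where
  "pick u = (SOME s. s \<in> cauchy_seqs \<and> code s = u)"

lemma pick:
  assumes "s \<in> cauchy_seqs"
  shows "pick (code s) \<in> cauchy_seqs" "code (pick (code s)) = code s"
    "lim_norm (\<lambda>n. pick (code s) n - s n) = 0"
proof -
  show *: "pick (code s) \<in> cauchy_seqs" "code (pick (code s)) = code s"
    using someI[of "\<lambda>t. t \<in> cauchy_seqs \<and> code t = code s" s] assms by (auto simp: pick_def)
  show "lim_norm (\<lambda>n. pick (code s) n - s n) = 0"
    using * code_eq_iff[of "pick (code s)" s] assms by simp
qed

section \<open>Vector operations and norm on codes\<close>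

definition completion :: "(nat \<Rightarrow> real) nspace" where
  "completion = \<lparr>car = code ` cauchy_seqs, zer = code (\<lambda>_. 0),
     plu = (\<lambda>u v. code (\<lambda>n. pick u n + pick v n)),
     scl = (\<lambda>a u. code (\<lambda>n. a *\<^sub>R pick u n)),
     nrm = (\<lambda>u. lim_norm (pick u))\<rparr>"

lemma car_completion: "car completion = code ` cauchy_seqs"
  and zer_completion: "zer completion = code (\<lambda>_. 0)"
  by (simp_all add: completion_def)

lemma lim_norm_add:
  assumes "s \<in> cauchy_seqs" "t \<in> cauchy_seqs"
  shows "lim_norm (\<lambda>n. s n + t n) \<le> lim_norm s + lim_norm t"
  by (rule LIMSEQ_le[OF lim_norm tendsto_add[OF lim_norm lim_norm]])
    (use assms N_triangle in auto)

lemma lim_norm_scale: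
  assumes "s \<in> cauchy_seqs"
  shows "lim_norm (\<lambda>n. a *\<^sub>R s n) = \<bar>a\<bar> * lim_norm s"
proof (rule LIMSEQ_unique[OF lim_norm])
  show "(\<lambda>n. N (a *\<^sub>R s n)) \<longlonglongrightarrow> \<bar>a\<bar> * lim_norm s"
    using tendsto_mult[OF tendsto_const lim_norm[OF assms], of "\<bar>a\<bar>"] N_scale assms by simp
qed (use assms in auto)

text \<open>The errors made by replacing \<open>s\<close> and \<open>t\<close> by the chosen
  representatives have limit norm 0, hence so does their sum, and \<open>code_eq_iff\<close>
  identifies the codes.\<close>

lemma plu_completion:
  assumes s: "s \<in> cauchy_seqs" and t: "t \<in> cauchy_seqs"
  shows "plu completion (code s) (code t) = code (\<lambda>n. s n + t n)"
proof -
  note p = pick[OF s] pick[OF t]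
  have "lim_norm (\<lambda>n. pick (code s) n - s n + (pick (code t) n - t n)) \<le> 0"
    using lim_norm_add[of "\<lambda>n. pick (code s) n - s n" "\<lambda>n. pick (code t) n - t n"] p s t by simp
  moreover have "0 \<le> lim_norm (\<lambda>n. pick (code s) n - s n + (pick (code t) n - t n))"
    using p s t by (intro lim_norm_nonneg) auto
  ultimately show ?thesis
    using p s t by (simp add: completion_def code_eq_iff algebra_simps)
qed

lemma scl_completion:
  assumes s: "s \<in> cauchy_seqs"
  shows "scl completion a (code s) = code (\<lambda>n. a *\<^sub>R s n)"
  using lim_norm_scale[of "\<lambda>n. pick (code s) n - s n" a] pick[OF s] s
  by (simp add: completion_def code_eq_iff scaleR_diff_right)

lemma vdiff_completion:
  assumes s: "s \<in> cauchy_seqs" and t: "t \<in> cauchy_seqs"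
  shows "vdiff completion (code s) (code t) = code (\<lambda>n. s n - t n)"
  using s t plu_completion[of s "\<lambda>n. (-1) *\<^sub>R t n"] cauchy_seqs_scale[of t "-1"]
  by (simp add: vdiff_def scl_completion)

lemma nrm_completion:
  assumes s: "s \<in> cauchy_seqs"
  shows "nrm completion (code s) = lim_norm s"
proof -
  note p = pick[OF s]
  have "(\<lambda>n. N (pick (code s) n) - N (s n)) \<longlonglongrightarrow> 0"
  proof (rule Lim_null_comparison)
    show "(\<lambda>n. N (pick (code s) n - s n)) \<longlonglongrightarrow> 0"
      using lim_norm[of "\<lambda>n. pick (code s) n - s n"] p s by simp
    show "\<forall>\<^sub>F n in sequentially. norm (N (pick (code s) n) - N (s n)) \<le> N (pick (code s) n - s n)"
      using N_abs_diff p s by simp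
  qed
  moreover have "(\<lambda>n. N (pick (code s) n) - N (s n)) \<longlonglongrightarrow> lim_norm (pick (code s)) - lim_norm s"
    by (intro tendsto_diff lim_norm) (use p s in auto)
  ultimately have "lim_norm (pick (code s)) - lim_norm s = 0" using LIMSEQ_unique by fastforce
  then show ?thesis by (simp add: completion_def)
qed

lemmas completion_simps =
  car_completion zer_completion plu_completion scl_completion vdiff_completion nrm_completion

lemma normed_completion: "is_normed_space completion"
proof -
  have "\<exists>t\<in>cauchy_seqs. plu completion (code s) (code t) = zer completion"
    if "s \<in> cauchy_seqs" for s
    using that plu_completion[of s "\<lambda>n. (-1) *\<^sub>R s n"] cauchy_seqs_scale[of s "-1"]
    by (intro bexI[of _ "\<lambda>n. (-1) *\<^sub>R s n"]) (simp_all add: zer_completion)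
  then have "is_vector_space completion"
    unfolding is_vector_space_def
    by (simp add: completion_simps ac_simps scaleR_add_right scaleR_add_left)
  moreover have "lim_norm s = 0 \<longleftrightarrow> code s = code (\<lambda>_. 0)" if "s \<in> cauchy_seqs" for s
    using that code_eq_iff[of s "\<lambda>_. 0"] by simp
  then have "is_norm completion (nrm completion)"
    unfolding is_norm_def
    by (simp add: completion_simps lim_norm_nonneg lim_norm_add lim_norm_scale)
  ultimately show ?thesis by (simp add: is_normed_space_def)
qed

sublocale completion: Metric_space "car completion" "norm_dist completion"
  by (rule Metric_space_norm_dist[OF normed_completion])

lemma norm_dist_completion:
  "s \<in> cauchy_seqs \<Longrightarrow> t \<in> cauchy_seqs \<Longrightarrow>
     norm_dist completion (code s) (code t) = lim_norm (\<lambda>n. s n - t n)"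
  by (simp add: norm_dist_def completion_simps)

lemma code_in [simp, intro]: "s \<in> cauchy_seqs \<Longrightarrow> code s \<in> car completion"
  by (simp add: car_completion)

section \<open>Dense embedding and completeness\<close>

definition emb :: "'u \<Rightarrow> nat \<Rightarrow> real" where
  "emb w = code (\<lambda>_. w)"

lemma emb_in [simp, intro]: "w \<in> W \<Longrightarrow> emb w \<in> car completion"
  by (auto simp: emb_def)

lemma norm_dist_emb: "x \<in> W \<Longrightarrow> y \<in> W \<Longrightarrow> norm_dist completion (emb x) (emb y) = N (x - y)"
  by (simp add: emb_def norm_dist_completion)

lemma plu_emb: "x \<in> W \<Longrightarrow> y \<in> W \<Longrightarrow> plu completion (emb x) (emb y) = emb (x + y)"
  by (simp add: emb_def plu_completion)

lemma emb_tail: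
  assumes s: "s \<in> cauchy_seqs" and "e > 0"
  shows "\<exists>K. \<forall>k\<ge>K. norm_dist completion (code s) (emb (s k)) \<le> e"
  using lim_norm_tail[OF assms] s by (simp add: emb_def norm_dist_completion)

lemma emb_dense:
  assumes "u \<in> car completion" "e > 0"
  shows "\<exists>w\<in>W. norm_dist completion u (emb w) < e"
proof -
  obtain s where s: "s \<in> cauchy_seqs" "u = code s" using assms by (auto simp: car_completion)
  from emb_tail[OF s(1), of "e/2"] assms obtain K where
    "norm_dist completion (code s) (emb (s K)) \<le> e/2" by auto
  then show ?thesis using s assms by (intro bexI[of _ "s K"]) auto
qed

text \<open>Replace the k-th term of a Cauchy sequence of codes by an embedded vector
  \<open>w k\<close> at distance below 1/(k+1). Then \<open>w\<close> is itself Cauchy for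
  \<open>N\<close>, and its code is the limit; no diagonal sequence is required.\<close>

lemma banach_completion: "is_banach_space completion"
proof -
  have "completion.mcomplete"
    unfolding completion.mcomplete_def
  proof (intro allI impI)
    fix \<sigma> assume \<sigma>: "completion.MCauchy \<sigma>"
    then have \<sigma>in: "\<sigma> k \<in> car completion" for k by (auto simp: completion.MCauchy_def)
    have "\<forall>k. \<exists>w\<in>W. norm_dist completion (\<sigma> k) (emb w) < inverse (real (Suc k))"
      using emb_dense[OF \<sigma>in] by simp
    then obtain w where w: "\<And>k. w k \<in> W"
      "\<And>k. norm_dist completion (\<sigma> k) (emb (w k)) < inverse (real (Suc k))" by metis
    have close: "\<exists>K. \<forall>k\<ge>K. norm_dist completion (\<sigma> k) (emb (w k)) < e" if e: "e > 0" for e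
    proof -
      obtain K where K: "inverse (real (Suc K)) < e" using reals_Archimedean[OF e] by blast
      have "norm_dist completion (\<sigma> k) (emb (w k)) < e" if "k \<ge> K" for k
      proof -
        have "inverse (real (Suc k)) \<le> inverse (real (Suc K))" using that by simp
        then show ?thesis using w(2)[of k] K by linarith
      qed
      then show ?thesis by blast
    qed
    have wC: "w \<in> cauchy_seqs"
      unfolding cauchy_seqs_def
    proof (intro CollectI conjI allI impI)
      fix e :: real assume "e > 0"
      then obtain K where K: "\<forall>k\<ge>K. norm_dist completion (\<sigma> k) (emb (w k)) < e/3"
        using close[of "e/3"] by auto
      from \<sigma> \<open>e > 0\<close> obtain L where
        L: "\<And>m n. m \<ge> L \<Longrightarrow> n \<ge> L \<Longrightarrow> norm_dist completion (\<sigma> m) (\<sigma> n) < e/3"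
        unfolding completion.MCauchy_def by (meson divide_pos_pos zero_less_numeral)
      have "N (w m - w n) < e" if "m \<ge> max K L" "n \<ge> max K L" for m n
      proof -
        have "norm_dist completion (emb (w m)) (emb (w n)) \<le>
            norm_dist completion (\<sigma> m) (emb (w m)) + norm_dist completion (\<sigma> m) (\<sigma> n) +
            norm_dist completion (\<sigma> n) (emb (w n))"
          using completion.triangle[of "emb (w m)" "\<sigma> m" "emb (w n)"]
            completion.triangle[of "\<sigma> m" "\<sigma> n" "emb (w n)"] w \<sigma>in
            completion.commute[of "\<sigma> m" "emb (w m)"] by auto
        moreover have "norm_dist completion (\<sigma> m) (emb (w m)) < e/3"
          "norm_dist completion (\<sigma> n) (emb (w n)) < e/3" using K that by auto
        moreover have "norm_dist completion (\<sigma> m) (\<sigma> n) < e/3" using L that by auto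
        ultimately show ?thesis using norm_dist_emb w by auto
      qed
      then show "\<exists>K. \<forall>m\<ge>K. \<forall>n\<ge>K. N (w m - w n) < e" by blast
    qed (use w in auto)
    have "limitin completion.mtopology \<sigma> (code w) sequentially"
      unfolding completion.limit_metric_sequentially
    proof (intro conjI allI impI)
      fix e :: real assume "e > 0"
      then obtain K L where K: "\<forall>k\<ge>K. norm_dist completion (\<sigma> k) (emb (w k)) < e/2"
        and L: "\<forall>k\<ge>L. norm_dist completion (code w) (emb (w k)) \<le> e/2"
        using close[of "e/2"] emb_tail[OF wC, of "e/2"] by auto
      have "norm_dist completion (\<sigma> k) (code w) < e" if "k \<ge> max K L" for k
      proof -
        have "norm_dist completion (\<sigma> k) (emb (w k)) < e/2"
          "norm_dist completion (code w) (emb (w k)) \<le> e/2" using K L that by auto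
        then show ?thesis
          using completion.triangle[of "\<sigma> k" "emb (w k)" "code w"] w \<sigma>in wC
            completion.commute[of "code w" "emb (w k)"] by auto
      qed
      then show "\<exists>K. \<forall>k\<ge>K. \<sigma> k \<in> car completion \<and> norm_dist completion (\<sigma> k) (code w) < e"
        using \<sigma>in by blast
    qed (use wC in auto)
    then show "\<exists>u. limitin completion.mtopology \<sigma> u sequentially" by blast
  qed
  then show ?thesis
    using normed_completion
    by (simp add: is_banach_space_def mcomplete_of_def norm_metric_simps)
qed

text \<open>The terms of a Cauchy sequence representing a unit vector need not have norm 1, so the
  definition does not pass to limits directly. The quadratic inequality puts no restriction on the
  norms, holds termwise and survives with the same constant.\<close>

lemma uniformly_convex_completion:
  assumes "\<And>\<epsilon>. \<epsilon> > 0 \<Longrightarrow> \<exists>C>0. \<forall>x\<in>W. \<forall>y\<in>W.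
    (N (x - y))\<^sup>2 \<le> \<epsilon> * ((N x)\<^sup>2 + (N y)\<^sup>2) + C * (((N x)\<^sup>2 + (N y)\<^sup>2) / 2 - (N ((1/2) *\<^sub>R (x + y)))\<^sup>2)"
  shows "uniformly_convex_norm completion (nrm completion)"
proof (rule uniformly_convex_normI)
  fix \<epsilon> :: real assume "\<epsilon> > 0"
  from assms[OF this] obtain C where C: "C > 0" and le: "\<And>x y. x \<in> W \<Longrightarrow> y \<in> W \<Longrightarrow>
    (N (x - y))\<^sup>2 \<le> \<epsilon> * ((N x)\<^sup>2 + (N y)\<^sup>2) + C * (((N x)\<^sup>2 + (N y)\<^sup>2) / 2 - (N ((1/2) *\<^sub>R (x + y)))\<^sup>2)"
    by blast
  have "(lim_norm (\<lambda>n. s n - t n))\<^sup>2 \<le> \<epsilon> * ((lim_norm s)\<^sup>2 + (lim_norm t)\<^sup>2) +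
      C * (((lim_norm s)\<^sup>2 + (lim_norm t)\<^sup>2) / 2 - (lim_norm (\<lambda>n. (1/2) *\<^sub>R (s n + t n)))\<^sup>2)"
    if "s \<in> cauchy_seqs" "t \<in> cauchy_seqs" for s t
  proof (rule LIMSEQ_le)
    show "(\<lambda>n. (N (s n - t n))\<^sup>2) \<longlonglongrightarrow> (lim_norm (\<lambda>n. s n - t n))\<^sup>2"
      by (intro tendsto_intros lim_norm) (use that in auto)
    show "(\<lambda>n. \<epsilon> * ((N (s n))\<^sup>2 + (N (t n))\<^sup>2) +
        C * (((N (s n))\<^sup>2 + (N (t n))\<^sup>2) / 2 - (N ((1/2) *\<^sub>R (s n + t n)))\<^sup>2)) \<longlonglongrightarrow>
      \<epsilon> * ((lim_norm s)\<^sup>2 + (lim_norm t)\<^sup>2) +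
      C * (((lim_norm s)\<^sup>2 + (lim_norm t)\<^sup>2) / 2 - (lim_norm (\<lambda>n. (1/2) *\<^sub>R (s n + t n)))\<^sup>2)"
      by (intro tendsto_intros lim_norm) (use that in auto)
  qed (use le that in auto)
  then show "\<exists>C>0. \<forall>x\<in>car completion. \<forall>y\<in>car completion.
      (nrm completion (vdiff completion x y))\<^sup>2 \<le> \<epsilon> * ((nrm completion x)\<^sup>2 + (nrm completion y)\<^sup>2) +
      C * (((nrm completion x)\<^sup>2 + (nrm completion y)\<^sup>2) / 2 -
        (nrm completion (scl completion (1/2) (plu completion x y)))\<^sup>2)"
    using C by (intro exI[of _ C]) (auto simp: completion_simps)
qed

section \<open>Extension of isometries to the completion\<close>

definition lift :: "('u \<Rightarrow> 'u) \<Rightarrow> (nat \<Rightarrow> real) \<Rightarrow> nat \<Rightarrow> real" where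
  "lift T u = code (\<lambda>n. T (pick u n))"

definition isometric :: "('u \<Rightarrow> 'u) \<Rightarrow> bool" where
  "isometric T \<longleftrightarrow> linear T \<and> T ` W \<subseteq> W \<and> (\<forall>w\<in>W. N (T w) = N w)"

context
  fixes T assumes T: "isometric T"
begin

lemma isometric_in: "w \<in> W \<Longrightarrow> T w \<in> W"
  and isometric_norm: "w \<in> W \<Longrightarrow> N (T w) = N w"
  and isometric_add: "T (x + y) = T x + T y"
  and isometric_diff: "T (x - y) = T x - T y"
  and isometric_scale: "T (a *\<^sub>R x) = a *\<^sub>R T x"
  using T by (auto simp: isometric_def linear_add linear_diff linear_scale)

lemma isometric_cauchy_seqs:
  assumes "s \<in> cauchy_seqs"
  shows "(\<lambda>n. T (s n)) \<in> cauchy_seqs"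
  using assms isometric_norm[of "s _ - s _"]
  by (auto simp: cauchy_seqs_def isometric_in simp flip: isometric_diff)

lemma isometric_lim_norm: "s \<in> cauchy_seqs \<Longrightarrow> lim_norm (\<lambda>n. T (s n)) = lim_norm s"
  by (simp add: lim_norm_def isometric_norm)

text \<open>An isometry preserves the relation of having difference of limit norm 0, so the image
  does not depend on the representative.\<close>

lemma lift_code:
  assumes s: "s \<in> cauchy_seqs"
  shows "lift T (code s) = code (\<lambda>n. T (s n))"
  using pick[OF s] s isometric_lim_norm[of "\<lambda>n. pick (code s) n - s n"]
  by (simp add: lift_def code_eq_iff isometric_cauchy_seqs isometric_diff)

lemma lift_emb: "w \<in> W \<Longrightarrow> lift T (emb w) = emb (T w)"
  by (simp add: emb_def lift_code)

lemma linear_isometry_lift: "linear_isometry completion (lift T)"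
  unfolding linear_isometry_def
  by (simp add: completion_simps lift_code isometric_cauchy_seqs isometric_lim_norm
      isometric_add isometric_scale)

lemma norm_dist_lift:
  "u \<in> car completion \<Longrightarrow> v \<in> car completion \<Longrightarrow>
    norm_dist completion (lift T u) (lift T v) = norm_dist completion u v"
  using isometric_lim_norm[of "\<lambda>n. _ n - _ n"]
  by (auto simp: car_completion lift_code norm_dist_completion isometric_cauchy_seqs
      isometric_diff)

end

lemma isometric_representation_lift:
  assumes "\<And>x. isometric (T x)" "\<And>w. w \<in> W \<Longrightarrow> T 0 w = w"
    "\<And>x y w. w \<in> W \<Longrightarrow> T (x + y) w = T x (T y w)"
  shows "isometric_representation completion (\<lambda>x. lift (T x))"
  unfolding isometric_representation_def
  using assms
  by (auto simp: linear_isometry_lift car_completion lift_code isometric_cauchy_seqs)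

lemma continuous_map_completionI:
  assumes "\<And>x. f x \<in> car completion"
    "\<And>x e. e > 0 \<Longrightarrow> \<forall>\<^sub>F y in nhds x. norm_dist completion (f x) (f y) < e"
  shows "continuous_map euclidean (mtopology_of (norm_metric completion)) f"
proof -
  have "\<exists>U. openin euclidean U \<and> x \<in> U \<and> (\<forall>y\<in>U. f y \<in> completion.mball (f x) e)" if "e > 0" for x e
    using assms(1) assms(2)[OF that, of x] by (auto simp: eventually_nhds)
  then have "continuous_map euclidean completion.mtopology f"
    using assms(1) by (simp add: completion.continuous_map_to_metric)
  then show ?thesis by (simp add: mtopology_of_def norm_metric_simps[OF normed_completion])
qed

text \<open>All the lifted maps are isometries, hence equicontinuous; continuity of orbits on the
  dense image of \<open>W\<close> therefore extends to the completion by an e/3 argument.\<close>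

lemma strongly_continuous_lift:
  fixes T :: "'x::topological_group_add \<Rightarrow> 'u \<Rightarrow> 'u"
  assumes T: "\<And>x. isometric (T x)"
    and cont: "\<And>x w e. w \<in> W \<Longrightarrow> e > 0 \<Longrightarrow> \<forall>\<^sub>F y in nhds x. N (T x w - T y w) < e"
  shows "strongly_continuous completion (\<lambda>x. lift (T x))"
  unfolding strongly_continuous_def
proof (intro ballI continuous_map_completionI)
  have in': "lift (T x) u \<in> car completion" if "u \<in> car completion" for x u
    using linear_isometry_lift[OF T] that by (auto simp: linear_isometry_def)
  fix u assume u: "u \<in> car completion"
  then show "lift (T x) u \<in> car completion" for x by (rule in')
  fix x and e :: real assume "e > 0"
  then obtain w where w: "w \<in> W" "norm_dist completion u (emb w) < e/3"
    using emb_dense[OF u, of "e/3"] by auto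
  have "\<forall>\<^sub>F y in nhds x. N (T x w - T y w) < e/3"
    by (rule cont) (use w \<open>e > 0\<close> in auto)
  then show "\<forall>\<^sub>F y in nhds x. norm_dist completion (lift (T x) u) (lift (T y) u) < e"
  proof eventually_elim
    case (elim y)
    have "norm_dist completion (lift (T x) u) (lift (T y) u) \<le>
      norm_dist completion (lift (T x) u) (lift (T x) (emb w)) +
      norm_dist completion (lift (T x) (emb w)) (lift (T y) (emb w)) +
      norm_dist completion (lift (T y) u) (lift (T y) (emb w))"
      using completion.triangle[of "lift (T x) u" "lift (T x) (emb w)" "lift (T y) u"]
        completion.triangle[of "lift (T x) (emb w)" "lift (T y) (emb w)" "lift (T y) u"]
        completion.commute[of "lift (T y) u" "lift (T y) (emb w)"] in' u w by auto
    also have "\<dots> = 2 * norm_dist completion u (emb w) + N (T x w - T y w)"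
      using norm_dist_lift[OF T u emb_in[OF w(1)]] T w(1)
      by (simp add: lift_emb norm_dist_emb isometric_in)
    also have "\<dots> < e" using elim w by simp
    finally show ?case .
  qed
qed

end

subsection \<open>The averaged embedding\<close>

text \<open>The segment from v to u is cut into n + 1 equal steps shorter than d, and \<sigma> moves
  less than 1 across each of them.\<close>

lemma uniformly_continuous_bounded_displacement:
  fixes \<sigma> :: "'a::real_normed_vector \<Rightarrow> 'b::real_normed_vector"
  assumes "uniformly_continuous_on UNIV \<sigma>"
  shows "\<exists>L\<ge>0. \<forall>u v. norm (u - v) \<le> t \<longrightarrow> norm (\<sigma> u - \<sigma> v) \<le> L"
proof -
  obtain d where d: "d > 0" "\<And>u v. dist u v < d \<Longrightarrow> dist (\<sigma> u) (\<sigma> v) < 1"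
    using assms unfolding uniformly_continuous_on_def by (metis UNIV_I zero_less_one)
  obtain n where n: "t / d < real n" using reals_Archimedean2 by blast
  have "norm (\<sigma> u - \<sigma> v) \<le> real n + 1" if "norm (u - v) \<le> t" for u v
  proof -
    define p where "p i = v + (real i / (real n + 1)) *\<^sub>R (u - v)" for i
    have "norm (\<sigma> (p i) - \<sigma> v) \<le> real i" for i
    proof (induction i)
      case (Suc i)
      have "p (Suc i) - p i = (1 / (real n + 1)) *\<^sub>R (u - v)"
        by (simp add: p_def add_divide_distrib flip: scaleR_left_diff_distrib)
      then have "dist (p (Suc i)) (p i) = norm (u - v) / (real n + 1)"
        by (simp add: dist_norm)
      also have "\<dots> \<le> t / (real n + 1)" using that by (intro divide_right_mono) auto
      also have "\<dots> < d"
        using n d(1) by (simp add: divide_less_eq algebra_simps)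
      finally have "norm (\<sigma> (p (Suc i)) - \<sigma> (p i)) < 1"
        using d(2) by (simp add: dist_norm)
      then show ?case
        using Suc norm_triangle_ineq[of "\<sigma> (p (Suc i)) - \<sigma> (p i)" "\<sigma> (p i) - \<sigma> v"] by simp
    qed (simp add: p_def)
    moreover have "p (Suc n) = u" by (simp add: p_def add.commute[of 1])
    ultimately show ?thesis by (metis of_nat_Suc add.commute)
  qed
  then show ?thesis by (intro exI[of _ "real n + 1"]) auto
qed

text \<open>The first factor is discrete, so near a point the first coordinate is constant. This
  places functions on \<open>nat \<times> 'a\<close> in the type of bounded continuous
  functions.\<close>

lemma continuous_on_nat_prod:
  fixes f :: "nat \<times> 'a::topological_space \<Rightarrow> 'b::topological_space"
  assumes "\<And>n. continuous_on UNIV (\<lambda>g. f (n, g))"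
  shows "continuous_on UNIV f"
  unfolding continuous_on_def
proof (intro ballI)
  fix z :: "nat \<times> 'a"
  obtain n g where z: "z = (n, g)" by force
  have "((\<lambda>g. f (n, g)) \<longlongrightarrow> f (n, g)) (nhds g)"
    using assms[of n] tendsto_at_iff_tendsto_nhds[of "\<lambda>g. f (n, g)" g]
    by (simp add: continuous_on_def)
  then have "((\<lambda>y. f (n, snd y)) \<longlongrightarrow> f (n, g)) (nhds z)"
    unfolding z by (rule filterlim_compose) (auto simp: nhds_prod filterlim_snd)
  moreover have "\<forall>\<^sub>F y in nhds z. f (n, snd y) = f y"
    unfolding eventually_nhds z
    by (intro exI[of _ "{n} \<times> UNIV"]) (auto simp: open_Times open_discrete)
  ultimately have "(f \<longlongrightarrow> f z) (nhds z)" using Lim_transform_eventually z by blast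
  then show "(f \<longlongrightarrow> f z) (at z within UNIV)" by (simp add: tendsto_at_iff_tendsto_nhds[of f])
qed


lemma uniformly_continuous_scales:
  fixes \<sigma> :: "'a::real_normed_vector \<Rightarrow> 'b::real_normed_vector"
  assumes "uniformly_continuous_on UNIV \<sigma>"
  obtains l :: "nat \<Rightarrow> real" where "\<And>n. l n > 0" "\<And>n. l n \<le> 1"
    "\<And>n u v. norm (u - v) \<le> l n * (real n + 1) \<Longrightarrow> norm (\<sigma> u - \<sigma> v) \<le> (1/2) ^ n"
proof -
  have "\<exists>r. r > 0 \<and> r \<le> 1 \<and> (\<forall>u v. norm (u - v) \<le> r * (real n + 1) \<longrightarrow> norm (\<sigma> u - \<sigma> v) \<le> (1/2) ^ n)"
    for n
  proof -
    have "(1/2 :: real) ^ n > 0" by simp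
    then obtain d where d: "d > 0" "\<And>u v. dist u v < d \<Longrightarrow> dist (\<sigma> u) (\<sigma> v) < (1/2) ^ n"
      using assms unfolding uniformly_continuous_on_def by (metis UNIV_I)
    \<comment> \<open>The factor 2 makes r (n + 1) fall strictly below d. The cap at 1 means that
      scaling never increases distances, so bounds on the displacement of \<sigma> hold at all
      levels simultaneously.\<close>
    define r where "r = min 1 (d / (2 * (real n + 1)))"
    have "r * (real n + 1) \<le> d / (2 * (real n + 1)) * (real n + 1)"
      unfolding r_def by (intro mult_right_mono) auto
    also have "\<dots> = d / 2" by (simp add: field_simps)
    also have "\<dots> < d" using d(1) by simp
    finally have "r * (real n + 1) < d" .
    moreover have "r > 0" "r \<le> 1" using d(1) by (auto simp: r_def)
    ultimately show ?thesis using d(2) by (intro exI[of _ r]) (auto simp: dist_norm intro!: less_imp_le)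
  qed
  then show ?thesis using that by metis
qed

text \<open>The renorming \<open>P\<close> is averaged in place of the original norm, so that its
  convexity can be used pointwise; \<open>c\<close> and \<open>C\<close> transfer estimates on
  \<sigma> to \<open>P\<close>. Convexity of \<open>P\<close> enters as a hypothesis of
  \<open>N_defect\<close>.\<close>

locale averaged_embedding =
  fixes \<sigma> :: "'a::real_normed_vector \<Rightarrow> 'b::real_normed_vector"
    and P :: "'b \<Rightarrow> real" and c C :: real
    and m :: "('a \<Rightarrow> real) \<Rightarrow> real" and l :: "nat \<Rightarrow> real"
  assumes P: "is_norm type_space P"
    and c: "c > 0" "\<And>x. c * norm x \<le> P x"
    and C: "C > 0" "\<And>x. P x \<le> C * norm x"
    and m: "is_mean m" and m_inv: "\<And>f a. bounded (range f) \<Longrightarrow> m (\<lambda>x. f (x + a)) = m f"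
    and unif: "uniformly_continuous_on UNIV \<sigma>"
    and l: "\<And>n. l n > 0" "\<And>n. l n \<le> 1"
    and close: "\<And>n u v. norm (u - v) \<le> l n * (real n + 1) \<Longrightarrow> norm (\<sigma> u - \<sigma> v) \<le> (1/2) ^ n"
begin

lemma P_nonneg [simp]: "P x \<ge> 0" and P_triangle: "P (x + y) \<le> P x + P y"
  and P_scale: "P (a *\<^sub>R x) = \<bar>a\<bar> * P x"
  using P by (auto simp: is_norm_def)

text \<open>Formally the coboundary of (n, g) \<mapsto> \<sigma>(l n g) under the translation
  action. That function may be unbounded, but its differences are bounded, by uniform continuity and
  l n \<le> 1. The type of bounded continuous functions provides a vector space whose elements a
  mean can average; its supremum norm is not the norm of the target.\<close>

definition B :: "'a \<Rightarrow> ((nat \<times> 'a) \<Rightarrow>\<^sub>C 'b)" where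
  "B x = Bcontfun (\<lambda>(n, g). \<sigma> (l n *\<^sub>R (x + g)) - \<sigma> (l n *\<^sub>R g))"

lemma B_apply [simp]: "apply_bcontfun (B x) (n, g) = \<sigma> (l n *\<^sub>R (x + g)) - \<sigma> (l n *\<^sub>R g)"
proof -
  have cont: "continuous_on S \<sigma>" for S
    using uniformly_continuous_imp_continuous[OF unif] continuous_on_subset by blast
  obtain L where L: "\<And>u v. norm (u - v) \<le> norm x \<Longrightarrow> norm (\<sigma> u - \<sigma> v) \<le> L"
    using uniformly_continuous_bounded_displacement[OF unif] by blast
  have "norm (\<sigma> (l n *\<^sub>R (x + g)) - \<sigma> (l n *\<^sub>R g)) \<le> L" for n g
    using l(1)[of n] l(2)[of n] mult_right_mono[OF l(2)[of n] norm_ge_zero[of x]]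
    by (intro L) (simp add: scaleR_diff_right[symmetric])
  moreover have "continuous_on UNIV (\<lambda>(n, g). \<sigma> (l n *\<^sub>R (x + g)) - \<sigma> (l n *\<^sub>R g))"
    by (intro continuous_on_nat_prod) (auto intro!: continuous_intros continuous_on_compose2[OF cont])
  ultimately have "(\<lambda>(n, g). \<sigma> (l n *\<^sub>R (x + g)) - \<sigma> (l n *\<^sub>R g)) \<in> bcontfun"
    by (intro bcontfun_normI) auto
  then show ?thesis by (simp add: B_def Bcontfun_inverse)
qed

section \<open>The translation action\<close>

definition T :: "'a \<Rightarrow> ((nat \<times> 'a) \<Rightarrow>\<^sub>C 'b) \<Rightarrow> ((nat \<times> 'a) \<Rightarrow>\<^sub>C 'b)" where
  "T x F = Bcontfun (\<lambda>(n, g). apply_bcontfun F (n, g + x))"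

lemma T_apply [simp]: "apply_bcontfun (T x F) (n, g) = apply_bcontfun F (n, g + x)"
proof -
  have "continuous_on UNIV (\<lambda>(n, g). apply_bcontfun F (n, g + x))"
    unfolding case_prod_beta
    by (intro continuous_on_compose2[OF continuous_on_apply_bcontfun[of UNIV F]] continuous_intros) auto
  then have "(\<lambda>(n, g). apply_bcontfun F (n, g + x)) \<in> bcontfun"
    using norm_bounded[of F] by (intro bcontfun_normI[of _ "norm F"]) auto
  then show ?thesis by (simp add: T_def Bcontfun_inverse)
qed

lemma bcontfun_prod_eqI:
  "(\<And>n g. apply_bcontfun F (n, g) = apply_bcontfun G (n, g)) \<Longrightarrow> F = G"
  for F G :: "(nat \<times> 'a) \<Rightarrow>\<^sub>C 'b"
  by (rule bcontfun_eqI) auto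

lemma T_linear: "linear (T x)"
  by (rule linearI) (auto intro: bcontfun_prod_eqI)

lemma T_0: "T 0 F = F"
  and T_add: "T (x + y) F = T x (T y F)"
  and T_B: "T x (B y) = B (x + y) - B x"
  by (auto intro!: bcontfun_prod_eqI simp: ac_simps)

text \<open>Finite additivity does not let the mean pass through a series, so each level n is
  averaged separately and the averages are summed afterwards.\<close>

definition q :: "((nat \<times> 'a) \<Rightarrow>\<^sub>C 'b) \<Rightarrow> nat \<Rightarrow> real" where
  "q F n = m (\<lambda>g. (P (apply_bcontfun F (n, g)))\<^sup>2)"

lemma P_sq_bounded: "bounded (range (\<lambda>g. (P (apply_bcontfun F (n, g)))\<^sup>2))"
proof (rule bounded_range_realI)
  fix g
  have "P (apply_bcontfun F (n, g)) \<le> C * norm F"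
    using C norm_bounded[of F "(n, g)"] by (meson mult_left_mono less_imp_le order_trans)
  then show "\<bar>(P (apply_bcontfun F (n, g)))\<^sup>2\<bar> \<le> (C * norm F)\<^sup>2"
    by (simp add: power_mono)
qed

lemma q_nonneg: "0 \<le> q F n"
  unfolding q_def by (rule mean_nonneg[OF m P_sq_bounded]) simp

lemma q_le: "(\<And>g. P (apply_bcontfun F (n, g)) \<le> b) \<Longrightarrow> q F n \<le> b\<^sup>2"
  unfolding q_def by (intro mean_le[OF m]) (auto intro: power_mono)

lemma q_ge: "0 \<le> b \<Longrightarrow> (\<And>g. b \<le> P (apply_bcontfun F (n, g))) \<Longrightarrow> b\<^sup>2 \<le> q F n"
  unfolding q_def by (intro mean_ge[OF m P_sq_bounded]) (auto intro: power_mono)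

lemma q_scale: "q (a *\<^sub>R F) n = a\<^sup>2 * q F n"
  using mean_cmult[OF m P_sq_bounded[of F n], of "a\<^sup>2"]
  by (simp add: q_def P_scale power_mult_distrib)

lemma q_T: "q (T x F) n = q F n"
  using m_inv[OF P_sq_bounded[of F n], of x] by (simp add: q_def)

text \<open>Linearity and positivity of the mean on bounded functions. Two squares on each side
  cover all uses: the crude bound for sums, the family behind Minkowski's inequality and the
  convexity inequality, with zero coefficients as padding.\<close>

lemma q_mono_combination:
  assumes "\<And>z. \<alpha> * (P (apply_bcontfun F z))\<^sup>2 + \<beta> * (P (apply_bcontfun G z))\<^sup>2
    \<le> \<gamma> * (P (apply_bcontfun H z))\<^sup>2 + \<delta> * (P (apply_bcontfun K z))\<^sup>2"
  shows "\<alpha> * q F n + \<beta> * q G n \<le> \<gamma> * q H n + \<delta> * q K n"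
proof -
  have b: "bounded (range (\<lambda>g. a * (P (apply_bcontfun F (n, g)))\<^sup>2))" for a F
    using bounded_scaleR_comp[OF P_sq_bounded[of F n], of a] by simp
  have "\<alpha> * q F n + \<beta> * q G n =
    m (\<lambda>g. \<alpha> * (P (apply_bcontfun F (n, g)))\<^sup>2 + \<beta> * (P (apply_bcontfun G (n, g)))\<^sup>2)" for \<alpha> \<beta> F G
    unfolding q_def by (simp add: mean_add[OF m] mean_cmult[OF m] b P_sq_bounded)
  then show ?thesis
    using assms by (auto intro!: mean_mono[OF m] bounded_plus_comp b)
qed

section \<open>Square-summable families and the seminorm\<close>

definition square_summable :: "((nat \<times> 'a) \<Rightarrow>\<^sub>C 'b) set" where
  "square_summable = {F. summable (q F)}"

definition Q :: "((nat \<times> 'a) \<Rightarrow>\<^sub>C 'b) \<Rightarrow> real" where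
  "Q F = (\<Sum>n. q F n)"

definition N :: "((nat \<times> 'a) \<Rightarrow>\<^sub>C 'b) \<Rightarrow> real" where
  "N F = sqrt (Q F)"

lemma square_summableI: "summable f \<Longrightarrow> (\<And>n. q F n \<le> f n) \<Longrightarrow> F \<in> square_summable"
  unfolding square_summable_def
  by (auto intro!: summable_comparison_test[of "q F" f] simp: q_nonneg)

lemma Q_le: "summable f \<Longrightarrow> (\<And>n. q F n \<le> f n) \<Longrightarrow> Q F \<le> suminf f"
  using square_summableI[of f F] by (auto simp: Q_def square_summable_def intro: suminf_le)

lemma Q_nonneg: "F \<in> square_summable \<Longrightarrow> 0 \<le> Q F"
  by (simp add: Q_def suminf_nonneg q_nonneg square_summable_def)

lemma Q_mono_combination:
  assumes "F \<in> square_summable" "G \<in> square_summable" "H \<in> square_summable" "K \<in> square_summable"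
    and "\<And>z. \<alpha> * (P (apply_bcontfun F z))\<^sup>2 + \<beta> * (P (apply_bcontfun G z))\<^sup>2
      \<le> \<gamma> * (P (apply_bcontfun H z))\<^sup>2 + \<delta> * (P (apply_bcontfun K z))\<^sup>2"
  shows "\<alpha> * Q F + \<beta> * Q G \<le> \<gamma> * Q H + \<delta> * Q K"
proof -
  have *: "(\<lambda>n. \<alpha> * q F n + \<beta> * q G n) sums (\<alpha> * Q F + \<beta> * Q G)"
    if "F \<in> square_summable" "G \<in> square_summable" for \<alpha> \<beta> F G
    unfolding Q_def using that
    by (intro sums_add sums_mult summable_sums) (auto simp: square_summable_def)
  show ?thesis
    by (rule sums_le[OF q_mono_combination *[OF assms(1,2)] *[OF assms(3,4)]]) (rule assms)
qed

text \<open>The span is invariant under \<open>T\<close> by the cocycle identity \<open>T_B\<close>,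
  and on it continuity of orbits and separability reduce to the generators
  \<open>B x\<close>.\<close>

definition W :: "((nat \<times> 'a) \<Rightarrow>\<^sub>C 'b) set" where
  "W = span (range B)"

section \<open>Estimates for the cocycle at each level\<close>

lemma q_B_diff_le:
  assumes "\<And>g. norm (\<sigma> (l n *\<^sub>R (x + g)) - \<sigma> (l n *\<^sub>R (y + g))) \<le> b"
  shows "q (B x - B y) n \<le> (C * b)\<^sup>2"
proof (rule q_le)
  fix g
  have "P (apply_bcontfun (B x - B y) (n, g)) \<le> C * norm (\<sigma> (l n *\<^sub>R (x + g)) - \<sigma> (l n *\<^sub>R (y + g)))"
    using C(2) by simp
  also have "\<dots> \<le> C * b" using assms C(1) by simp
  finally show "P (apply_bcontfun (B x - B y) (n, g)) \<le> C * b" .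
qed

lemma scaled_dist: "norm (l n *\<^sub>R (x + g) - l n *\<^sub>R (y + g)) = l n * norm (x - y)"
  using l(1)[of n] by (simp add: scaleR_diff_right[symmetric])

lemma q_B_diff_small:
  assumes "norm (x - y) \<le> real n + 1"
  shows "q (B x - B y) n \<le> C\<^sup>2 * (1/4) ^ n"
proof -
  have "q (B x - B y) n \<le> (C * (1/2) ^ n)\<^sup>2"
    by (intro q_B_diff_le close) (use assms l(1)[of n] in \<open>auto simp: scaled_dist\<close>)
  also have "\<dots> = C\<^sup>2 * (1/4) ^ n"
    by (simp add: power2_eq_square flip: power_mult_distrib)
  finally show ?thesis .
qed

text \<open>The crude displacement bound serves on the levels n < k, the geometric bound on the
  rest, where t \<le> n + 1. That the majorant does not depend on x and y gives finiteness of
  \<open>theta\<close> as well as summability.\<close>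

lemma q_B_diff_bound:
  obtains f where "summable f" "\<And>x y n. norm (x - y) \<le> t \<Longrightarrow> q (B x - B y) n \<le> f n"
proof -
  obtain L where L: "\<And>u v. norm (u - v) \<le> t \<Longrightarrow> norm (\<sigma> u - \<sigma> v) \<le> L"
    using uniformly_continuous_bounded_displacement[OF unif] by blast
  obtain k where k: "t \<le> real k" using real_arch_simple by blast
  define f where "f n = C\<^sup>2 * (1/4) ^ n + (if n < k then (C * L)\<^sup>2 else 0)" for n
  have "summable f"
    unfolding f_def
    by (intro summable_add summable_mult summable_geometric summable_finite[of "{..<k}"]) auto
  moreover have "q (B x - B y) n \<le> f n" if "norm (x - y) \<le> t" for x y n
  proof (cases "n < k")
    case True
    have "q (B x - B y) n \<le> (C * L)\<^sup>2"
    proof (intro q_B_diff_le L)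
      fix g
      show "norm (l n *\<^sub>R (x + g) - l n *\<^sub>R (y + g)) \<le> t"
        using mult_right_mono[OF l(2)[of n] norm_ge_zero[of "x - y"]] that by (simp add: scaled_dist)
    qed
    also have "\<dots> \<le> f n" using True C(1) by (simp add: f_def)
    finally show ?thesis .
  next
    case False
    then have "norm (x - y) \<le> real n + 1" using that k by linarith
    from q_B_diff_small[OF this] show ?thesis using False by (simp add: f_def)
  qed
  ultimately show ?thesis using that by blast
qed

lemma B_0: "B 0 = 0"
  by (rule bcontfun_prod_eqI) simp

lemma subspace_square_summable: "subspace square_summable"
  unfolding subspace_def
proof (intro conjI ballI allI)
  show "0 \<in> square_summable"
  proof -
    have "q 0 = (\<lambda>_. 0)" using q_scale[of 0 0] by (simp add: fun_eq_iff)
    then show ?thesis by (simp add: square_summable_def)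
  qed
next
  fix F G assume FG: "F \<in> square_summable" "G \<in> square_summable"
  have "(P (x + y))\<^sup>2 \<le> 2 * (P x)\<^sup>2 + 2 * (P y)\<^sup>2" for x y
  proof -
    have "(P (x + y))\<^sup>2 \<le> (P x + P y)\<^sup>2" by (intro power_mono P_triangle) simp
    also have "\<dots> \<le> 2 * (P x)\<^sup>2 + 2 * (P y)\<^sup>2"
      using sum_squares_bound[of "P x" "P y"] by (simp add: power2_sum)
    finally show ?thesis .
  qed
  then have "q (F + G) n \<le> 2 * q F n + 2 * q G n" for n
    using q_mono_combination[of 1 "F + G" 0 F 2 F 2 G n] by simp
  moreover have "summable (\<lambda>n. 2 * q F n + 2 * q G n)"
    using FG by (intro summable_add summable_mult) (auto simp: square_summable_def)
  ultimately show "F + G \<in> square_summable" by (rule square_summableI[rotated])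
next
  fix a F assume "F \<in> square_summable"
  then show "a *\<^sub>R F \<in> square_summable"
    by (auto simp: square_summable_def q_scale[abs_def] intro: summable_mult)
qed

lemma W_subset: "W \<subseteq> square_summable"
  unfolding W_def
proof (rule span_minimal[OF _ subspace_square_summable], safe)
  fix x :: 'a
  obtain f where "summable f" "\<And>y z n. norm (y - z) \<le> norm x \<Longrightarrow> q (B y - B z) n \<le> f n"
    using q_B_diff_bound by blast
  from this(1) this(2)[of x 0] show "B x \<in> square_summable"
    by (intro square_summableI[of f]) (auto simp: B_0)
qed

lemma subspace_W: "subspace W" and B_in_W [simp]: "B x \<in> W"
  by (auto simp: W_def intro: span_base)

lemma W_induct [consumes 1, case_names zero step]:
  assumes "F \<in> W" "R 0" "\<And>a x F. F \<in> W \<Longrightarrow> R F \<Longrightarrow> R (a *\<^sub>R B x + F)"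
  shows "R F"
proof -
  have "F \<in> W \<and> R F"
    using assms(1) unfolding W_def
  proof (induction rule: span_induct_alt)
    case (step a G F)
    then show ?case
      using assms(3) subspace_W by (auto simp: W_def intro!: subspace_add subspace_scale intro: span_base)
  qed (use assms(2) in \<open>auto intro: span_zero\<close>)
  then show ?thesis ..
qed

lemma N_sq: "F \<in> W \<Longrightarrow> (N F)\<^sup>2 = Q F"
  using W_subset Q_nonneg by (auto simp: N_def)

lemma N_scale: "N (a *\<^sub>R F) = \<bar>a\<bar> * N F" if "F \<in> W"
proof -
  have "Q (a *\<^sub>R F) = a\<^sup>2 * Q F"
    using that W_subset unfolding Q_def q_scale by (intro suminf_mult) (auto simp: square_summable_def)
  then show ?thesis by (simp add: N_def real_sqrt_mult)
qed

text \<open>Minkowski's inequality: optimize \<open>t\<close> in \<open>(x + y)\<^sup>2 \<le> (1 + t) x\<^sup>2 + (1 + 1/t) y\<^sup>2\<close>.\<close>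

lemma N_triangle:
  assumes "F \<in> W" "G \<in> W"
  shows "N (F + G) \<le> N F + N G"
proof (rule field_le_epsilon)
  fix e :: real assume "e > 0"
  \<comment> \<open>The summand e/2 keeps a and b positive when a seminorm vanishes, so that t = b/a
    is admissible; with this t the final bound is exactly (a + b)^2.\<close>
  define a b where "a = N F + e/2" and "b = N G + e/2"
  have ab: "a > 0" "b > 0" "N F \<le> a" "N G \<le> b" "N F \<ge> 0" "N G \<ge> 0"
    using \<open>e > 0\<close> assms W_subset Q_nonneg by (auto simp: a_def b_def N_def intro!: add_nonneg_pos)
  define t where "t = b / a"
  have t: "t > 0" using ab by (simp add: t_def)
  have sq: "(u + v)\<^sup>2 \<le> (1 + t) * u\<^sup>2 + (1 + 1/t) * v\<^sup>2" for u v :: real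
  proof -
    have "0 \<le> (t * u - v)\<^sup>2 / t" using t by simp
    also have "\<dots> = t * u\<^sup>2 - 2 * u * v + v\<^sup>2 / t"
      using t by (simp add: power2_eq_square field_simps)
    finally show ?thesis by (simp add: power2_sum algebra_simps)
  qed
  have FGW: "F + G \<in> W" using assms subspace_W by (simp add: subspace_add)
  have "1 * Q (F + G) + 0 * Q F \<le> (1 + t) * Q F + (1 + 1/t) * Q G"
  proof (rule Q_mono_combination)
    fix z
    have "(P (apply_bcontfun (F + G) z))\<^sup>2 \<le> (P (apply_bcontfun F z) + P (apply_bcontfun G z))\<^sup>2"
      using P_triangle by (intro power_mono) auto
    also note sq
    finally show "1 * (P (apply_bcontfun (F + G) z))\<^sup>2 + 0 * (P (apply_bcontfun F z))\<^sup>2 \<le>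
      (1 + t) * (P (apply_bcontfun F z))\<^sup>2 + (1 + 1/t) * (P (apply_bcontfun G z))\<^sup>2" by simp
  qed (use assms FGW W_subset in auto)
  then have "(N (F + G))\<^sup>2 \<le> (1 + t) * (N F)\<^sup>2 + (1 + 1/t) * (N G)\<^sup>2"
    by (simp add: N_sq assms FGW)
  also have "\<dots> \<le> (1 + t) * a\<^sup>2 + (1 + 1/t) * b\<^sup>2"
    using t ab by (intro add_mono mult_left_mono power_mono) auto
  also have "\<dots> = (a + b)\<^sup>2"
    using ab by (simp add: t_def power2_eq_square field_simps)
  finally have "N (F + G) \<le> a + b" by (rule power2_le_imp_le) (use ab in simp)
  then show "N (F + G) \<le> N F + N G + e" by (simp add: a_def b_def)
qed

text \<open>With the midpoint term moved to the left, the inequality for \<open>P\<close> has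
  nonnegative coefficients 1 and K against \<epsilon> + K/2 twice, the shape of
  \<open>Q_mono_combination\<close>; averaging and summing leave K unchanged.\<close>

lemma N_defect:
  assumes "uniformly_convex_norm type_space P" "\<epsilon> > 0"
  shows "\<exists>K>0. \<forall>F\<in>W. \<forall>G\<in>W. (N (F - G))\<^sup>2 \<le> \<epsilon> * ((N F)\<^sup>2 + (N G)\<^sup>2) +
    K * (((N F)\<^sup>2 + (N G)\<^sup>2) / 2 - (N ((1/2) *\<^sub>R (F + G)))\<^sup>2)"
proof -
  obtain K where K: "K > 0" "\<And>x y. (P (x - y))\<^sup>2 \<le> \<epsilon> * ((P x)\<^sup>2 + (P y)\<^sup>2) +
       K * (((P x)\<^sup>2 + (P y)\<^sup>2) / 2 - (P ((1/2) *\<^sub>R (x + y)))\<^sup>2)"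
    using uniformly_convex_defect[OF P assms] by blast
  have K': "1 * (P (x - y))\<^sup>2 + K * (P ((1/2) *\<^sub>R (x + y)))\<^sup>2 \<le>
      (\<epsilon> + K/2) * (P x)\<^sup>2 + (\<epsilon> + K/2) * (P y)\<^sup>2" for x y
    using K(2)[of x y] by (simp add: algebra_simps add_divide_distrib)
  have "(N (F - G))\<^sup>2 \<le> \<epsilon> * ((N F)\<^sup>2 + (N G)\<^sup>2) +
      K * (((N F)\<^sup>2 + (N G)\<^sup>2) / 2 - (N ((1/2) *\<^sub>R (F + G)))\<^sup>2)" if "F \<in> W" "G \<in> W" for F G
  proof -
    have in': "F - G \<in> W" "(1/2) *\<^sub>R (F + G) \<in> W"
      using that subspace_W by (auto intro!: subspace_diff subspace_scale subspace_add)
    have "1 * Q (F - G) + K * Q ((1/2) *\<^sub>R (F + G)) \<le> (\<epsilon> + K/2) * Q F + (\<epsilon> + K/2) * Q G"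
      by (rule Q_mono_combination)
        (use that in' W_subset K'[of "apply_bcontfun F _" "apply_bcontfun G _"] in auto)
    then show ?thesis using that in' by (simp add: N_sq algebra_simps add_divide_distrib)
  qed
  with K(1) show ?thesis by blast
qed

section \<open>Invariance of the seminorm and continuity of the action\<close>

lemma T_W: "T x ` W \<subseteq> W"
proof -
  have "T x ` range B \<subseteq> W"
    using subspace_W by (auto simp: T_B intro!: subspace_diff)
  then show ?thesis
    unfolding W_def using linear_span_image[OF T_linear] span_minimal[OF _ subspace_span] by metis
qed

lemma N_T: "N (T x F) = N F"
  by (simp add: N_def Q_def q_T[abs_def])

text \<open>Dominated convergence over the levels: each level tends to 0 by uniform continuity of
  \<sigma>, and at distance below 1 the choice of scales dominates level n by C^2 / 4^n.\<close>

lemma N_B_diff_continuous: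
  assumes "e > 0"
  shows "\<forall>\<^sub>F y in nhds x. N (B x - B y) < e"
proof -
  have "((\<lambda>y. q (B x - B y) n) \<longlongrightarrow> 0) (nhds x)" for n
  proof (rule tendstoI)
    fix r :: real assume "r > 0"
    define s where "s = sqrt (r/2) / C"
    have s: "s > 0" using \<open>r > 0\<close> C(1) by (simp add: s_def)
    obtain d where d: "d > 0" "\<And>u v. dist u v < d \<Longrightarrow> dist (\<sigma> u) (\<sigma> v) < s"
      using unif s unfolding uniformly_continuous_on_def by (metis UNIV_I)
    have "\<forall>\<^sub>F y in nhds x. dist y x < d" using d(1) by (auto simp: eventually_nhds_metric)
    then show "\<forall>\<^sub>F y in nhds x. dist (q (B x - B y) n) 0 < r"
    proof eventually_elim
      case (elim y)
      have "q (B x - B y) n \<le> (C * s)\<^sup>2"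
      proof (intro q_B_diff_le less_imp_le)
        fix g
        have "l n * norm (x - y) < d"
          using elim mult_right_mono[OF l(2)[of n] norm_ge_zero[of "x - y"]]
          by (simp add: dist_norm norm_minus_commute)
        then show "norm (\<sigma> (l n *\<^sub>R (x + g)) - \<sigma> (l n *\<^sub>R (y + g))) < s"
          using d(2)[of "l n *\<^sub>R (x + g)" "l n *\<^sub>R (y + g)"] by (simp add: dist_norm scaled_dist)
      qed
      also have "\<dots> = r/2" using C(1) \<open>r > 0\<close> by (simp add: s_def)
      finally show ?case using \<open>r > 0\<close> q_nonneg[of "B x - B y" n] by simp
    qed
  qed
  moreover have "\<forall>\<^sub>F (n, y) in at_top \<times>\<^sub>F nhds x. norm (q (B x - B y) n) \<le> C\<^sup>2 * (1/4) ^ n"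
  proof (rule eventually_prodI[where P = "\<lambda>_. True" and Q = "\<lambda>y. dist y x < 1", THEN eventually_mono])
    show "\<forall>\<^sub>F y in nhds x. dist y x < 1" by (auto simp: eventually_nhds_metric intro: exI[of _ 1])
    show "case z of (n, y) \<Rightarrow> norm (q (B x - B y) n) \<le> C\<^sup>2 * (1/4) ^ n"
      if "True \<and> dist (snd z) x < 1" for z :: "nat \<times> 'a"
      using that q_B_diff_small[of x "snd z" "fst z"] q_nonneg
      by (auto simp: case_prod_beta dist_norm norm_minus_commute)
  qed simp
  moreover have "summable (\<lambda>n. C\<^sup>2 * (1/4 :: real) ^ n)" by (intro summable_mult summable_geometric) simp
  ultimately have "((\<lambda>y. Q (B x - B y)) \<longlongrightarrow> (\<Sum>n::nat. 0)) (nhds x)"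
    unfolding Q_def
    using tannerys_theorem[of "\<lambda>n y. q (B x - B y) n" "\<lambda>_. 0" "nhds x"] by auto
  then have "((\<lambda>y. N (B x - B y)) \<longlongrightarrow> sqrt 0) (nhds x)"
    unfolding N_def by (intro tendsto_real_sqrt) simp
  from order_tendstoD(2)[OF this, of e] assms show ?thesis by simp
qed

text \<open>On a generator, \<open>T_B\<close> turns T x (B z) - T y (B z) into (B (x + z) - B (y +
  z)) - (B x - B y), so continuity of the action follows from that of \<open>B\<close>; linearity
  extends it to the span.\<close>

lemma N_T_diff_continuous:
  assumes "F \<in> W" "e > 0"
  shows "\<forall>\<^sub>F y in nhds x. N (T x F - T y F) < e"
  using assms
proof (induction arbitrary: e rule: W_induct)
  case zero
  have "N 0 = 0" using N_scale[of 0 0] subspace_W by (simp add: subspace_0)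
  then show ?case using zero linear_0[OF T_linear] by simp
next
  case (step a z F)
  define G where G: "G = B z"
  have W: "T y H \<in> W" if "H \<in> W" for y H using T_W that by blast
  have FW: "F \<in> W" "G \<in> W" using step G by auto
  define r where "r = e / (4 * (\<bar>a\<bar> + 1))"
  have r: "r > 0" "\<bar>a\<bar> * (2 * r) < e/2 + e/4"
    using step.prems by (auto simp: r_def field_simps add_pos_nonneg)
  have "filterlim (\<lambda>y. y + z) (nhds (x + z)) (nhds x)"
    by (intro tendsto_intros filterlim_ident)
  from filterlim_iff[THEN iffD1, OF this, rule_format, OF N_B_diff_continuous[OF r(1)]]
  have "\<forall>\<^sub>F y in nhds x. N (B (x + z) - B (y + z)) < r" .
  moreover have "\<forall>\<^sub>F y in nhds x. N (B x - B y) < r" by (rule N_B_diff_continuous[OF r(1)])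
  moreover have "\<forall>\<^sub>F y in nhds x. N (T x F - T y F) < e/4" using step.IH[of "e/4"] step.prems by simp
  ultimately show ?case
    unfolding G[symmetric]
  proof eventually_elim
    case (elim y)
    have in': "T x G - T y G \<in> W" "T x F - T y F \<in> W"
      "B (x + z) - B (y + z) \<in> W" "(-1) *\<^sub>R (B x - B y) \<in> W" "B x - B y \<in> W"
      using W FW subspace_W by (auto intro!: subspace_diff subspace_scale)
    have "T x G - T y G = (B (x + z) - B (y + z)) + (-1) *\<^sub>R (B x - B y)"
      by (simp add: G T_B)
    then have "N (T x G - T y G) < 2 * r"
      using N_triangle[OF in'(3,4)] N_scale[OF in'(5), of "-1"] elim by simp
    then have "\<bar>a\<bar> * N (T x G - T y G) \<le> \<bar>a\<bar> * (2 * r)" by (intro mult_left_mono) auto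
    moreover have "T x (a *\<^sub>R G + F) - T y (a *\<^sub>R G + F) = a *\<^sub>R (T x G - T y G) + (T x F - T y F)"
      using T_linear by (simp add: linear_add linear_scale algebra_simps)
    then have "N (T x (a *\<^sub>R G + F) - T y (a *\<^sub>R G + F)) \<le>
        \<bar>a\<bar> * N (T x G - T y G) + N (T x F - T y F)"
      using N_triangle[of "a *\<^sub>R (T x G - T y G)" "T x F - T y F"] N_scale[OF in'(1), of a]
        in' subspace_scale[OF subspace_W] by simp
    ultimately show ?case using elim r(2) by linarith
  qed
qed

section \<open>Coarse upper and lower bounds\<close>

lemma N_B_diff_bounded: "\<exists>M. \<forall>x y. norm (x - y) \<le> t \<longrightarrow> N (B x - B y) \<le> M"
proof -
  obtain f where f: "summable f" "\<And>x y n. norm (x - y) \<le> t \<Longrightarrow> q (B x - B y) n \<le> f n"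
    using q_B_diff_bound by blast
  have "N (B x - B y) \<le> sqrt (suminf f)" if "norm (x - y) \<le> t" for x y
    unfolding N_def by (intro real_sqrt_le_mono Q_le f that)
  then show ?thesis by blast
qed

text \<open>The distance between the scaled points at level n does not depend on g. Once |x - y|
  \<ge> |t0| / l n, the gap \<delta> is therefore present for every g, and the average is at least
  (c \<delta>)^2.\<close>

lemma N_B_diff_unbounded:
  assumes "\<delta> > 0" and far: "\<And>u v. norm (u - v) \<ge> t0 \<Longrightarrow> norm (\<sigma> u - \<sigma> v) \<ge> \<delta>"
  shows "\<exists>t. \<forall>x y. norm (x - y) \<ge> t \<longrightarrow> N (B x - B y) \<ge> R"
proof -
  obtain K where K: "\<bar>R\<bar>\<^sup>2 / (c * \<delta>)\<^sup>2 \<le> real K" using real_arch_simple by blast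
  \<comment> \<open>A sum of nonnegative terms bounds each of them, so beyond t all levels n < K are
    active; K was chosen with K (c \<delta>)^2 \<ge> R^2.\<close>
  define t where "t = (\<Sum>n<K. \<bar>t0\<bar> / l n)"
  have "N (B x - B y) \<ge> R" if xy: "norm (x - y) \<ge> t" for x y
  proof -
    have q: "(c * \<delta>)\<^sup>2 \<le> q (B x - B y) n" if "n < K" for n
    proof (rule q_ge)
      fix g
      have "\<bar>t0\<bar> / l n \<le> t"
        unfolding t_def using that l(1) by (intro member_le_sum) (auto intro: divide_nonneg_pos)
      then have "\<bar>t0\<bar> / l n \<le> norm (x - y)" using xy by simp
      then have "t0 \<le> l n * norm (x - y)" using l(1)[of n] by (simp add: divide_le_eq mult.commute)
      then have "\<delta> \<le> norm (\<sigma> (l n *\<^sub>R (x + g)) - \<sigma> (l n *\<^sub>R (y + g)))"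
        by (intro far) (simp only: scaled_dist)
      then have "c * \<delta> \<le> c * norm (\<sigma> (l n *\<^sub>R (x + g)) - \<sigma> (l n *\<^sub>R (y + g)))"
        using c(1) by simp
      also have "\<dots> \<le> P (apply_bcontfun (B x - B y) (n, g))" using c(2) by simp
      finally show "c * \<delta> \<le> P (apply_bcontfun (B x - B y) (n, g))" .
    qed (use c \<open>\<delta> > 0\<close> in simp)
    have "\<bar>R\<bar>\<^sup>2 \<le> real K * (c * \<delta>)\<^sup>2"
      using K c(1) \<open>\<delta> > 0\<close> by (simp add: divide_le_eq)
    also have "\<dots> = (\<Sum>n<K. (c * \<delta>)\<^sup>2)" by simp
    also have "\<dots> \<le> (\<Sum>n<K. q (B x - B y) n)" using q by (intro sum_mono) auto
    also have "\<dots> \<le> Q (B x - B y)"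
      unfolding Q_def using W_subset subspace_diff[OF subspace_W B_in_W B_in_W]
      by (intro sum_le_suminf) (auto simp: q_nonneg square_summable_def)
    finally have "sqrt (\<bar>R\<bar>\<^sup>2) \<le> N (B x - B y)" unfolding N_def by (rule real_sqrt_le_mono)
    then show ?thesis by simp
  qed
  then show ?thesis by blast
qed

text \<open>Rational combinations of \<open>B\<close> at a dense sequence of points, encoded as
  lists so that they can be enumerated. Each induction step spends e/4 on rounding the coefficient,
  e/4 on moving the point and e/2 on the remaining sum.\<close>

lemma countable_dense_W:
  assumes "separable_space (euclidean :: 'a topology)"
  shows "\<exists>d :: nat \<Rightarrow> (nat \<times> 'a) \<Rightarrow>\<^sub>C 'b.
    (\<forall>k. d k \<in> W) \<and> (\<forall>F\<in>W. \<forall>e>0. \<exists>k. N (F - d k) < e)"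
proof -
  obtain S :: "'a set" where S: "countable S" "closure S = UNIV"
    using assms by (auto simp: separable_space_def)
  then have "S \<noteq> {}" by auto
  define y where "y = from_nat_into S"
  have y: "range y = S" using S \<open>S \<noteq> {}\<close> by (simp add: y_def range_from_nat_into)
  define D where "D k = (\<Sum>(r, j)\<leftarrow>k. real_of_rat r *\<^sub>R B (y j))" for k
  have DW: "D k \<in> W" for k
    by (induction k) (use subspace_W in \<open>auto simp: D_def subspace_0 intro!: subspace_add subspace_scale\<close>)
  have "\<exists>k. N (F - D k) < e" if "F \<in> W" "e > 0" for F e
    using that
  proof (induction arbitrary: e rule: W_induct)
    case zero
    have "N 0 = 0" using N_scale[of 0 0] subspace_W by (simp add: subspace_0)
    then show ?case using zero by (intro exI[of _ "[]"]) (simp add: D_def)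
  next
    case (step a x F)
    have FW: "F \<in> W" by (rule step)
    from step.IH[of "e/2"] step.prems obtain k where k: "N (F - D k) < e/2" by auto
    have cancel: "v * (e / (4 * v)) = e/4" "e / (4 * v) * v = e/4" if "v > 0" for v
      using that by simp_all
    have nn: "N (B u) \<ge> 0" for u by (simp add: N_def Q_nonneg W_subset[THEN subsetD])
    define \<eta> where "\<eta> = e / (4 * (N (B x) + 1))"
    have "N (B x) + 1 > 0" using nn[of x] by simp
    then have \<eta>: "\<eta> > 0" "\<eta> * (N (B x) + 1) = e/4"
      unfolding \<eta>_def using step.prems cancel by (simp, blast)
    obtain r where r: "a - \<eta> < real_of_rat r" "real_of_rat r < a"
      using of_rat_dense[of "a - \<eta>" a] \<eta>(1) by auto
    \<comment> \<open>The coefficient is rounded before the point is moved, because the allowed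
      displacement depends on r; the added 1 covers r = 0.\<close>
    define \<rho> where "\<rho> = e / (4 * (\<bar>real_of_rat r\<bar> + 1))"
    have "\<bar>real_of_rat r\<bar> + 1 > 0" by (rule add_nonneg_pos) auto
    then have \<rho>: "\<rho> > 0" "(\<bar>real_of_rat r\<bar> + 1) * \<rho> = e/4"
      unfolding \<rho>_def using step.prems by (intro divide_pos_pos mult_pos_pos cancel; simp)+
    from N_B_diff_continuous[OF \<rho>(1), of x] obtain U where U: "open U" "x \<in> U" "\<And>z. z \<in> U \<Longrightarrow> N (B x - B z) < \<rho>"
      by (auto simp: eventually_nhds)
    have "x \<in> closure S" using S by simp
    then have "S \<inter> U \<noteq> {}"
      using U(1,2) by (meson closure_iff_nhds_not_empty subset_refl)
    then obtain j where j: "N (B x - B (y j)) < \<rho>" using U(3) y by auto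
    have 1: "N ((a - real_of_rat r) *\<^sub>R B x) < e/4"
    proof -
      have "N ((a - real_of_rat r) *\<^sub>R B x) \<le> \<eta> * N (B x)"
        using r nn[of x] by (simp add: N_scale mult_right_mono)
      also have "\<dots> < \<eta> * (N (B x) + 1)" using \<eta>(1) by simp
      also note \<eta>(2)
      finally show ?thesis .
    qed
    have BW: "B x - B (y j) \<in> W" using subspace_W by (simp add: subspace_diff)
    have 2: "N (real_of_rat r *\<^sub>R (B x - B (y j))) < e/4"
    proof -
      have "N (real_of_rat r *\<^sub>R (B x - B (y j))) \<le> \<bar>real_of_rat r\<bar> * \<rho>"
        using j BW by (simp add: N_scale mult_left_mono)
      also have "\<dots> < (\<bar>real_of_rat r\<bar> + 1) * \<rho>" using \<rho>(1) by simp
      also note \<rho>(2)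
      finally show ?thesis .
    qed
    have "a *\<^sub>R B x + F - D ((r, j) # k) =
        ((a - real_of_rat r) *\<^sub>R B x + real_of_rat r *\<^sub>R (B x - B (y j))) + (F - D k)"
      by (simp add: D_def algebra_simps)
    also have "N \<dots> \<le> N ((a - real_of_rat r) *\<^sub>R B x + real_of_rat r *\<^sub>R (B x - B (y j))) + N (F - D k)"
      using subspace_W BW FW DW by (intro N_triangle) (auto intro!: subspace_add subspace_scale subspace_diff)
    also have "\<dots> \<le> N ((a - real_of_rat r) *\<^sub>R B x) + N (real_of_rat r *\<^sub>R (B x - B (y j))) + N (F - D k)"
      using subspace_W BW FW DW by (intro add_right_mono N_triangle) (auto intro!: subspace_scale)
    also have "\<dots> < e" using 1 2 k by simp
    finally show ?case by blast
  qed
  then have "\<exists>k. N (F - D (from_nat k)) < e" if "F \<in> W" "e > 0" for F e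
    using that by (metis from_nat_to_nat)
  then show ?thesis using DW by (intro exI[of _ "\<lambda>k. D (from_nat k)"]) blast
qed

end

section \<open>The cocycle in the completion\<close>

theorem theorem8:
  fixes \<sigma> :: "'a::banach \<Rightarrow> 'b::banach"
  assumes "separable_space (euclidean :: 'a topology)"
    and "super_reflexive (type_space :: 'b nspace)"
    and "uniformly_continuous_on UNIV \<sigma>"
    and "uncollapsed euclidean_metric euclidean_metric \<sigma>"
  shows "\<exists>(V :: (nat \<Rightarrow> real) nspace) (b :: 'a \<Rightarrow> (nat \<Rightarrow> real)).
           super_reflexive V \<and> continuous_cocycle V b \<and> coarsely_proper V b"
proof -
  obtain P where P: "equivalent_norm (type_space :: 'b nspace) P" "uniformly_convex_norm type_space P"
    using assms(2) by (auto simp: super_reflexive_def)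
  from P(1) obtain c C where PcC: "is_norm (type_space :: 'b nspace) P" "c > 0" "C > 0"
    "\<And>x. c * norm x \<le> P x" "\<And>x. P x \<le> C * norm x"
    by (auto simp: equivalent_norm_def)
  obtain m :: "('a \<Rightarrow> real) \<Rightarrow> real"
    where m: "is_mean m" and m_inv: "\<forall>f a. bounded (range f) \<longrightarrow> m (\<lambda>x. f (x + a)) = m f"
    using invariant_mean_exists by blast
  obtain l :: "nat \<Rightarrow> real" where l: "\<And>n. l n > 0" "\<And>n. l n \<le> 1"
    "\<And>n u v. norm (u - v) \<le> l n * (real n + 1) \<Longrightarrow> norm (\<sigma> u - \<sigma> v) \<le> (1/2) ^ n"
    by (rule uniformly_continuous_scales[OF assms(3)]) (rule that)
  interpret E: averaged_embedding \<sigma> P c C m l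
    by (rule averaged_embedding.intro[OF PcC(1,2,4,3,5) m m_inv[rule_format] assms(3) l])
  obtain d :: "nat \<Rightarrow> (nat \<times> 'a) \<Rightarrow>\<^sub>C 'b" where d: "\<forall>k. d k \<in> E.W" "\<forall>F\<in>E.W. \<forall>e>0. \<exists>k. E.N (F - d k) < e"
    using E.countable_dense_W[OF assms(1)] by blast
  interpret S: separable_seminorm E.W E.N d
  proof
    show "E.N (x + y) \<le> E.N x + E.N y" if "x \<in> E.W" "y \<in> E.W" for x y
      using that by (rule E.N_triangle)
    show "E.N (a *\<^sub>R x) = \<bar>a\<bar> * E.N x" if "x \<in> E.W" for a x
      using that by (rule E.N_scale)
    show "\<exists>k. E.N (x - d k) < e" if "x \<in> E.W" "e > 0" for x e
      using that d(2) by blast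
  qed (use E.subspace_W d(1) in auto)
  define b where "b x = S.emb (E.B x)" for x
  have b_in: "b x \<in> car S.completion" for x by (simp add: b_def S.emb_in)
  have b_dist: "norm_dist S.completion (b x) (b y) = E.N (E.B x - E.B y)" for x y
    by (simp add: b_def S.norm_dist_emb)
  have iso: "S.isometric (E.T x)" for x
    using E.T_linear E.T_W E.N_T by (auto simp: S.isometric_def)
  \<comment> \<open>The renorming is already built into \<open>E.N\<close>, so the norm of the
    completion serves as its own uniformly convex norm.\<close>
  have "equivalent_norm S.completion (nrm S.completion)"
    using S.normed_completion by (auto simp: equivalent_norm_def is_normed_space_def intro!: exI[of _ 1])
  then have "super_reflexive S.completion"
    using S.banach_completion S.uniformly_convex_completion[OF E.N_defect[OF P(2)]]
    by (auto simp: super_reflexive_def)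
  moreover have "continuous_cocycle S.completion b"
    unfolding continuous_cocycle_def
  proof (intro conjI exI[of _ "\<lambda>x. S.lift (E.T x)"] allI)
    show "continuous_map euclidean (mtopology_of (norm_metric S.completion)) b"
      by (intro S.continuous_map_completionI b_in) (simp add: b_dist E.N_B_diff_continuous)
    show "isometric_representation S.completion (\<lambda>x. S.lift (E.T x))"
      by (rule S.isometric_representation_lift[OF iso E.T_0 E.T_add])
    show "strongly_continuous S.completion (\<lambda>x. S.lift (E.T x))"
    proof (rule S.strongly_continuous_lift[OF iso])
      fix x w and e :: real
      assume "w \<in> E.W" "e > 0"
      then show "\<forall>\<^sub>F y in nhds x. E.N (E.T x w - E.T y w) < e"
        by (rule E.N_T_diff_continuous)
    qed
    show "b (x + y) = plu S.completion (S.lift (E.T x) (b y)) (b x)" for x y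
      using E.T_W by (simp add: b_def S.lift_emb[OF iso] E.T_B S.plu_emb)
  qed
  moreover have "coarsely_proper S.completion b"
    unfolding coarsely_proper_def coarse_embedding_def
  proof (intro conjI allI)
    note metric_simps = norm_metric_simps[OF S.normed_completion]
    show "b ` mspace euclidean_metric \<subseteq> mspace (norm_metric S.completion)"
      using b_in by (auto simp: metric_simps)
    show "theta euclidean_metric (norm_metric S.completion) b t < \<infinity>" for t
    proof -
      obtain M where "\<And>x y. norm (x - y) \<le> t \<Longrightarrow> E.N (E.B x - E.B y) \<le> M"
        using E.N_B_diff_bounded by blast
      then have "theta euclidean_metric (norm_metric S.completion) b t \<le> ennreal M"
        unfolding theta_def
        by (intro Sup_least) (auto simp: metric_simps b_dist dist_norm intro: ennreal_leI)
      also have "\<dots> < \<infinity>" by simp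
      finally show ?thesis .
    qed
    obtain t0 where t0: "kappa euclidean_metric euclidean_metric \<sigma> t0 > 0"
      using assms(4) by (auto simp: uncollapsed_def)
    \<comment> \<open>\<open>kappa\<close> is infinite when no two points are t0 apart; a value
      strictly below it is finite and converts to a real \<delta>.\<close>
    then obtain r where r: "0 < r" "r < kappa euclidean_metric euclidean_metric \<sigma> t0"
      using dense by blast
    define \<delta> where "\<delta> = enn2real r"
    have r_eq: "r = ennreal \<delta>" unfolding \<delta>_def using r by (metis ennreal_enn2real order_less_le_trans top_greatest)
    have \<delta>: "\<delta> > 0" using r r_eq by simp
    have far: "norm (\<sigma> u - \<sigma> v) \<ge> \<delta>" if "norm (u - v) \<ge> t0" for u v
    proof -
      have "r \<le> ennreal (dist (\<sigma> u) (\<sigma> v))"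
        by (rule order_trans[OF less_imp_le[OF r(2)]])
          (use that in \<open>auto simp: kappa_def dist_norm intro!: Inf_lower\<close>)
      then show ?thesis by (simp add: r_eq dist_norm)
    qed
    show "(kappa euclidean_metric (norm_metric S.completion) b \<longlongrightarrow> \<infinity>) at_top"
    proof (rule order_tendstoI)
      fix a :: ennreal assume "a < \<infinity>"
      then obtain R where R: "a < ennreal R" 
        using ennreal_Ex_less_of_nat[of a] by (auto simp: ennreal_of_nat_eq_real_of_nat less_top)
      obtain t where t: "\<And>x y. norm (x - y) \<ge> t \<Longrightarrow> E.N (E.B x - E.B y) \<ge> R"
        using E.N_B_diff_unbounded[OF \<delta> far] by blast
      have "a < kappa euclidean_metric (norm_metric S.completion) b s" if "s \<ge> t" for s
      proof -
        have "ennreal R \<le> kappa euclidean_metric (norm_metric S.completion) b s"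
          unfolding kappa_def using that t
          by (intro Inf_greatest) (auto simp: metric_simps b_dist dist_norm intro!: ennreal_leI)
        with R show ?thesis by (rule less_le_trans)
      qed
      then show "\<forall>\<^sub>F s in at_top. a < kappa euclidean_metric (norm_metric S.completion) b s"
        by (auto simp: eventually_at_top_linorder)
    qed simp
  qed
  ultimately show ?thesis by blast
qed

end
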